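(* Let $1\le p,q\le\infty$ with $1/p+1/q=1$. Then for all $\mathcal{A},\mathcal{B},\mathcal{C},\mathcal{D}\in\mathbb{R}^{n\times n\times n_3}$, $$2^{-|\frac1p-\frac12|}\big\|\mathcal{C}^T*\mathcal{A}+\mathcal{D}^T*\mathcal{B}\big\|_F\le n_3^{\frac1{2p}+\frac1{2q}-\frac12}\big\|\,|\mathcal{A}|^p+|\mathcal{B}|^p\,\big\|_F^{1/p}\cdot\big\|\,|\mathcal{C}|^q+|\mathcal{D}|^q\,\big\|_F^{1/q}$$ and $$2^{-|\frac1p-\frac12|}\big\|\mathcal{C}^T*\mathcal{A}+\mathcal{D}^T*\mathcal{B}\big\|_2\le \big\|\,|\mathcal{A}|^p+|\mathcal{B}|^p\,\big\|_2^{1/p}\cdot\big\|\,|\mathcal{C}|^q+|\mathcal{D}|^q\,\big\|_2^{1/q}.$$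
   Context: For $\mathcal{A}\in\mathbb{R}^{n_1\times n_2\times n_3}$ with frontal slices $A^{(1)},\dots,A^{(n_3)}$ (each $n_1\times n_2$), $\mathrm{bcirc}(\mathcal{A})$ is the $n_1n_3\times n_2n_3$ block circulant matrix whose first block column is $A^{(1)},A^{(2)},\dots,A^{(n_3)}$ (top to bottom), i.e. its $(i,j)$ block is $A^{(((i-j)\bmod n_3)+1)}$. $\mathrm{unfold}(\mathcal{A})$ is the first block column of $\mathrm{bcirc}(\mathcal{A})$ and $\mathrm{fold}$ is its inverse. The t-product of $\mathcal{A}\in\mathbb{R}^{n_1\times n_2\times n_3}$ and $\mathcal{B}\in\mathbb{R}^{n_2\times n_4\times n_3}$ is $\mathcal{A}*\mathcal{B}=\mathrm{fold}(\mathrm{bcirc}(\mathcal{A})\cdot\mathrm{unfold}(\mathcal{B}))\in\mathbb{R}^{n_1\times n_4\times n_3}$. The transpose $\mathcal{A}^{T}$ is obtained by transposing each frontal slice and reversing the order of the transposed slices $2,\dots,n_3$; $\mathcal{A}$ is symmetric if $\mathcal{A}^T=\mathcal{A}$. The inner product is $\langle\mathcal{X},\mathcal{Y}\rangle=\sum_{i,j,k}x_{ijk}y_{ijk}$. A tensor $\mathcal{A}\in\mathbb{R}^{n\times n\times n_3}$ is symmetric t-positive semidefinite, written $\mathcal{A}\ge0$, if it is symmetric and $\langle\mathcal{X},\mathcal{A}*\mathcal{X}\rangle\ge0$ for all nonzero $\mathcal{X}\in\mathbb{R}^{n\times1\times n_3}$. For $\mathcal{A}\ge0$ and a real number $r>0$,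 the power $\mathcal{A}^r$ (a tensor t-function) is the tensor with $\mathrm{bcirc}(\mathcal{A}^r)=(\mathrm{bcirc}(\mathcal{A}))^r$, the usual power of a positive semidefinite matrix. For any $\mathcal{A}\in\mathbb{R}^{n\times n\times n_3}$, $|\mathcal{A}|=(\mathcal{A}^T*\mathcal{A})^{1/2}$, which is symmetric t-positive semidefinite. Norms: $\|\mathcal{A}\|_F=\sqrt{\sum_{i,j,k}|a_{ijk}|^2}$ and $\|\mathcal{A}\|_2=\|\mathrm{bcirc}(\mathcal{A})\|_2$ (matrix spectral norm). Convention: $1/\infty=0$, and for an infinite exponent, $\|\,|\mathcal{A}|^p+|\mathcal{B}|^p\,\|^{1/p}$ denotes its limit as $p\to\infty$, namely $\max(\|\mathcal{A}\|_2,\|\mathcal{B}\|_2)$ (for either norm); similarly for $q$. *)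

theory Defs
  imports "HOL-Analysis.Analysis"
begin

(* A tensor in R^(n1 x n2 x n3) is an element of real^'n2^'n1^'n3: A $ k is the frontal slice with
   index k, and the (i,j,k) entry is A $ k $ i $ j.  The library norm and inner product of this type
   are the Frobenius norm and the entrywise inner product (see norm_tensor, inner_tensor).

   The slice index type is finite and linearly ordered; its elements, in increasing order, stand for
   1, ..., n3.  The order is used only to calculate with slice indices modulo n3 = CARD('n3). *)

type_synonym ('a, 'b, 'k) tensor = "real^'b^'a^'k"

lemma norm_tensor:
  "norm (A :: ('a::finite, 'b::finite, 'k::finite) tensor) =
     sqrt (\<Sum>k\<in>UNIV. \<Sum>i\<in>UNIV. \<Sum>j\<in>UNIV. \<bar>A $ k $ i $ j\<bar>\<^sup>2)"
  by (simp add: norm_vec_def L2_set_def sum_nonneg)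

lemma inner_tensor:
  "(X :: ('a::finite, 'b::finite, 'k::finite) tensor) \<bullet> Y =
     (\<Sum>k\<in>UNIV. \<Sum>i\<in>UNIV. \<Sum>j\<in>UNIV. X $ k $ i $ j * Y $ k $ i $ j)"
  by (simp add: inner_vec_def)

(* Zero-based position of a slice index: the index called k in 1, ..., n3 has slice_no k - 1. *)
definition slice_no :: "'k::{finite,linorder} \<Rightarrow> nat" where
  "slice_no k = card {..<k}"

definition slice_at :: "nat \<Rightarrow> 'k::{finite,linorder}" where
  "slice_at m = (THE k. slice_no k = m)"

lemma slice_no_mono: "k < l \<Longrightarrow> slice_no k < slice_no (l::'k::{finite,linorder})"
  unfolding slice_no_def by (rule psubset_card_mono) auto

lemma inj_slice_no: "inj (slice_no :: 'k::{finite,linorder} \<Rightarrow> nat)"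
  by (rule injI) (metis linorder_neqE slice_no_mono less_irrefl)

lemma slice_no_less: "slice_no (k::'k::{finite,linorder}) < CARD('k)"
  unfolding slice_no_def by (rule psubset_card_mono) auto

lemma bij_slice_no:
  "bij_betw (slice_no :: 'k::{finite,linorder} \<Rightarrow> nat) UNIV {..<CARD('k)}"
proof -
  have "range (slice_no :: 'k \<Rightarrow> nat) = {..<CARD('k)}"
    by (rule card_subset_eq) (auto simp: slice_no_less card_image inj_slice_no)
  then show ?thesis by (simp add: bij_betw_def inj_slice_no)
qed

lemma slice_at_no [simp]: "slice_at (slice_no k) = (k::'k::{finite,linorder})"
  unfolding slice_at_def by (rule the_equality) (auto dest: injD[OF inj_slice_no])

lemma slice_no_at [simp]:
  "m < CARD('k) \<Longrightarrow> slice_no (slice_at m :: 'k::{finite,linorder}) = m"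
  using bij_slice_no[where 'k='k] by (metis bij_betw_imp_surj_on imageE lessThan_iff slice_at_no)

definition first_slice :: "'k::{finite,linorder}" where
  "first_slice = slice_at 0"

(* (i - j) mod n3 + 1 in the one-based numbering of slices *)
definition slice_diff :: "'k::{finite,linorder} \<Rightarrow> 'k \<Rightarrow> 'k" where
  "slice_diff i j = slice_at (nat ((int (slice_no i) - int (slice_no j)) mod int CARD('k)))"

lemma slice_no_first [simp]: "slice_no (first_slice :: 'k::{finite,linorder}) = 0"
  by (simp add: first_slice_def)

lemma slice_no_diff:
  "int (slice_no (slice_diff i j)) =
     (int (slice_no i) - int (slice_no (j::'k::{finite,linorder}))) mod int CARD('k)"
proof -
  let ?m = "(int (slice_no i) - int (slice_no j)) mod int CARD('k)"
  have "0 \<le> ?m" "?m < int CARD('k)" by simp_all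
  then show ?thesis by (simp add: slice_diff_def nat_less_iff)
qed

lemma slice_diff_first [simp]: "slice_diff k first_slice = (k::'k::{finite,linorder})"
  by (simp add: slice_diff_def slice_no_less)

lemma slice_diff_swap:
  "slice_diff first_slice (slice_diff i j) = slice_diff j (i::'k::{finite,linorder})"
proof -
  have "int (slice_no (slice_diff first_slice (slice_diff i j))) = int (slice_no (slice_diff j i))"
    by (simp only: slice_no_diff slice_no_first) (simp add: mod_minus_eq)
  then show ?thesis by (simp add: inj_eq[OF inj_slice_no])
qed

(* Rows and columns of a block matrix are indexed by pairs (block, position within the block). *)
definition bcirc ::
  "('a, 'b, 'k) tensor \<Rightarrow> real^('k::{finite,linorder} \<times> 'b::finite)^('k \<times> 'a::finite)" where
  "bcirc A = (\<chi> r c. A $ slice_diff (fst r) (fst c) $ snd r $ snd c)"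

definition tunfold ::
  "('a, 'b, 'k) tensor \<Rightarrow> real^'b::finite^('k::{finite,linorder} \<times> 'a::finite)" where
  "tunfold A = (\<chi> r j. bcirc A $ r $ (first_slice, j))"

definition tfold ::
  "real^'b::finite^('k::{finite,linorder} \<times> 'a::finite) \<Rightarrow> ('a, 'b, 'k) tensor" where
  "tfold M = (\<chi> k i j. M $ (k, i) $ j)"

lemma tfold_tunfold: "tfold (tunfold A) = A"
  by (simp add: tfold_def tunfold_def bcirc_def vec_eq_iff)

lemma tunfold_tfold: "tunfold (tfold M) = M"
  by (simp add: tfold_def tunfold_def bcirc_def vec_eq_iff)

lemma bcirc_inject: "bcirc A = bcirc B \<longleftrightarrow> A = B"
  by (metis tfold_tunfold tunfold_def)

definition tprod ::
  "('a, 'b, 'k) tensor \<Rightarrow> ('b::finite, 'c, 'k) tensor \<Rightarrow>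
     ('a::finite, 'c::finite, 'k::{finite,linorder}) tensor" (infixl "\<star>" 70) where
  "A \<star> B = tfold (bcirc A ** tunfold B)"

(* Slice 1 stays in place and slice k moves to position n3 + 2 - k for k = 2, ..., n3. *)
definition ttranspose ::
  "('a, 'b, 'k) tensor \<Rightarrow> ('b::finite, 'a::finite, 'k::{finite,linorder}) tensor" where
  "ttranspose A = (\<chi> k. transpose (A $ slice_diff first_slice k))"

lemma bcirc_ttranspose: "bcirc (ttranspose A) = transpose (bcirc A)"
  by (simp add: bcirc_def ttranspose_def transpose_def vec_eq_iff slice_diff_swap)

definition tpsd :: "('a::finite, 'a, 'k::{finite,linorder}) tensor \<Rightarrow> bool" where
  "tpsd A \<longleftrightarrow> ttranspose A = A \<and>
     (\<forall>X :: ('a, 1, 'k) tensor. X \<noteq> 0 \<longrightarrow> X \<bullet> (A \<star> X) \<ge> 0)"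

lemma slice_diff_diff:
  "slice_diff (slice_diff k m) (slice_diff l m) = slice_diff k (l::'k::{finite,linorder})"
proof -
  have "int (slice_no (slice_diff (slice_diff k m) (slice_diff l m))) = int (slice_no (slice_diff k l))"
    by (simp add: slice_no_diff mod_simps)
  then show ?thesis by (simp add: inj_eq[OF inj_slice_no])
qed

lemma bij_slice_diff: "bij (\<lambda>l. slice_diff l (m::'k::{finite,linorder}))"
proof -
  have "inj (\<lambda>l. slice_diff l m)"
  proof (rule injI)
    fix k l assume "slice_diff k m = slice_diff l m"
    then have "slice_diff k l = slice_diff l l" by (metis slice_diff_diff)
    then have "(int (slice_no k) - int (slice_no l)) mod int CARD('k) = 0"
      using slice_no_diff[of k l] slice_no_diff[of l l] by simp
    then have "int (slice_no k) mod int CARD('k) = int (slice_no l) mod int CARD('k)"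
      by (metis mod_eq_dvd_iff dvd_eq_mod_eq_0)
    then have "slice_no k = slice_no l" by (simp add: slice_no_less)
    then show "k = l" by (simp add: inj_eq[OF inj_slice_no])
  qed
  then show ?thesis by (simp add: bij_def finite_UNIV_inj_surj)
qed

lemma bcirc_tprod: "bcirc (A \<star> B) = bcirc A ** bcirc B"
proof -
  have "bcirc (A \<star> B) $ (k, i) $ (m, j) = (bcirc A ** bcirc B) $ (k, i) $ (m, j)" for k i m j
  proof -
    have "bcirc (A \<star> B) $ (k, i) $ (m, j)
        = (\<Sum>l\<in>UNIV. \<Sum>b\<in>UNIV. A $ slice_diff (slice_diff k m) l $ i $ b * B $ l $ b $ j)"
      by (simp add: bcirc_def tprod_def tfold_def tunfold_def matrix_matrix_mult_def
          sum.cartesian_product flip: UNIV_Times_UNIV) (simp add: case_prod_unfold)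
    also have "\<dots> = (\<Sum>l\<in>UNIV. \<Sum>b\<in>UNIV. A $ slice_diff k l $ i $ b * B $ slice_diff l m $ b $ j)"
      by (subst sum.reindex_bij_betw[OF bij_slice_diff[of m], symmetric]) (simp add: slice_diff_diff)
    also have "\<dots> = (bcirc A ** bcirc B) $ (k, i) $ (m, j)"
      by (simp add: bcirc_def matrix_matrix_mult_def
          sum.cartesian_product flip: UNIV_Times_UNIV) (simp add: case_prod_unfold)
    finally show ?thesis .
  qed
  then show ?thesis by (simp add: vec_eq_iff split_paired_all)
qed

lemma inner_tunfold:
  "X \<bullet> Y = tunfold X \<bullet> tunfold (Y :: ('a::finite, 'b::finite, 'k::{finite,linorder}) tensor)"
  by (simp add: inner_vec_def tunfold_def bcirc_def sum.cartesian_product' flip: UNIV_Times_UNIV)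

lemma inner_matrix_transpose:
  "X \<bullet> (transpose M ** Y) = (M ** X) \<bullet> (Y :: real^'b::finite^'c::finite)"
proof -
  have "X \<bullet> (transpose M ** Y) = (\<Sum>i\<in>UNIV. \<Sum>j\<in>UNIV. \<Sum>l\<in>UNIV. X$i$j * (M$l$i * Y$l$j))"
    by (simp add: inner_vec_def matrix_matrix_mult_def transpose_def sum_distrib_left)
  also have "\<dots> = (\<Sum>j\<in>UNIV. \<Sum>i\<in>UNIV. \<Sum>l\<in>UNIV. X$i$j * (M$l$i * Y$l$j))"
    by (rule sum.swap)
  also have "\<dots> = (\<Sum>j\<in>UNIV. \<Sum>l\<in>UNIV. \<Sum>i\<in>UNIV. X$i$j * (M$l$i * Y$l$j))"
    by (rule sum.cong[OF refl], rule sum.swap)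
  also have "\<dots> = (\<Sum>l\<in>UNIV. \<Sum>j\<in>UNIV. \<Sum>i\<in>UNIV. X$i$j * (M$l$i * Y$l$j))"
    by (rule sum.swap)
  also have "\<dots> = (M ** X) \<bullet> Y"
    by (simp add: inner_vec_def matrix_matrix_mult_def sum_distrib_right mult.assoc mult.left_commute)
  finally show ?thesis .
qed

lemma tpsd_ttranspose_tprod:
  fixes A :: "('a::finite, 'a, 'k::{finite,linorder}) tensor"
  shows "tpsd (ttranspose A \<star> A)"
proof -
  have "ttranspose (ttranspose A \<star> A) = ttranspose A \<star> A"
    by (simp add: bcirc_ttranspose bcirc_tprod matrix_transpose_mul flip: bcirc_inject)
  moreover have "X \<bullet> ((ttranspose A \<star> A) \<star> X) \<ge> 0" for X :: "('a, 1, 'k) tensor"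
  proof -
    have "tunfold ((ttranspose A \<star> A) \<star> X) = transpose (bcirc A) ** (bcirc A ** tunfold X)"
      by (simp add: tprod_def[of "ttranspose A \<star> A"] tunfold_tfold bcirc_tprod bcirc_ttranspose
          matrix_mul_assoc)
    then have "X \<bullet> ((ttranspose A \<star> A) \<star> X) = (bcirc A ** tunfold X) \<bullet> (bcirc A ** tunfold X)"
      by (simp add: inner_tunfold inner_matrix_transpose)
    then show ?thesis by simp
  qed
  ultimately show ?thesis by (simp add: tpsd_def)
qed

definition diag_matrix :: "real^'n \<Rightarrow> real^'n^'n::finite" where
  "diag_matrix d = (\<chi> i j. if i = j then d $ i else 0)"

(* The power P = M^r (r > 0) of a positive semidefinite matrix M, by functional calculus: P does not
   depend on the choice of the orthogonal diagonalization of M.  Note that 0 powr r = 0. *)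
definition psd_matrix_powr :: "real^'n^'n::finite \<Rightarrow> real \<Rightarrow> real^'n^'n" where
  "psd_matrix_powr M r =
     (THE P. \<exists>U d. orthogonal_matrix U \<and> (\<forall>i. d $ i \<ge> 0) \<and>
        M = U ** diag_matrix d ** transpose U \<and>
        P = U ** diag_matrix (\<chi> i. d $ i powr r) ** transpose U)"

(* meaningful for tpsd A and r > 0 *)
definition tpowr ::
  "('a::finite, 'a, 'k::{finite,linorder}) tensor \<Rightarrow> real \<Rightarrow> ('a, 'a, 'k) tensor" where
  "tpowr A r = (THE T. bcirc T = psd_matrix_powr (bcirc A) r)"

definition tabs ::
  "('a::finite, 'a, 'k::{finite,linorder}) tensor \<Rightarrow> ('a, 'a, 'k) tensor" where
  "tabs A = tpowr (ttranspose A \<star> A) (1/2)"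

definition spectral_norm ::
  "('a::finite, 'b::finite, 'k::{finite,linorder}) tensor \<Rightarrow> real" where
  "spectral_norm A = onorm ((*v) (bcirc A))"

(* N(|A|^p + |B|^p)^(1/p), where N is the Frobenius or the spectral norm.  For p = \<infinity> this is by
   convention the limit as p tends to infinity, which for both norms is the maximum of the two
   spectral norms. *)
definition power_sum_norm ::
  "(('a, 'a, 'k) tensor \<Rightarrow> real) \<Rightarrow> ereal \<Rightarrow>
     ('a::finite, 'a, 'k::{finite,linorder}) tensor \<Rightarrow> ('a, 'a, 'k) tensor \<Rightarrow> real" where
  "power_sum_norm N p A B =
     (if p = \<infinity> then max (spectral_norm A) (spectral_norm B)
      else N (tpowr (tabs A) (real_of_ereal p) + tpowr (tabs B) (real_of_ereal p))
             powr (1 / real_of_ereal p))"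

end

theory Submission
  imports Defs
begin

text \<open>
The map \<open>bcirc\<close> is linear, injective and multiplicative and respects transposition, so both
inequalities are statements about square real matrices. It multiplies the Frobenius norm by the
square root of the number of slices; since \<open>1/p + 1/q = 1\<close>, these factors cancel, and
the power of the number of slices in the theorem equals 1. Transposition of the matrix on the left
exchanges \<open>(p, A, B)\<close> with \<open>(q, C, D)\<close>, so it is enough to treat \<open>p \<le> 2 \<le> q\<close>.

Let \<open>X\<close> be the block column of \<open>A\<close> over \<open>B\<close>, and \<open>Y\<close> that of \<open>C\<close> over \<open>D\<close>. The matrix on the
left is \<open>Y^T X\<close>. Its spectral norm is at most the product of the norms of \<open>X\<close> and \<open>Y\<close>, and
Hoelder's inequality bounds its Frobenius norm by traces of powers of the Gram matrices \<open>X^T X\<close>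
and \<open>Y^T Y\<close> (\<open>orthogonal_families_holder\<close>, with \<open>orthogonal_families_bound\<close> for \<open>q = \<infinity>\<close>).
It remains to compare the power with exponent \<open>p/2\<close> of \<open>X^T X = A^T A + B^T B\<close> with
\<open>|A|^p + |B|^p\<close>, which is the sum of the same powers of \<open>A^T A\<close> and \<open>B^T B\<close>, and to do
likewise for \<open>q\<close>, \<open>C\<close> and \<open>D\<close>.

For \<open>q/2 \<ge> 1\<close> this is Jensen's inequality in an eigenbasis of the Gram matrix. The power function is
convex, which costs the factor \<open>2^(q/2-1)\<close> (\<open>trace_gram2_powr_le_convex\<close>,
\<open>norm_stack_le_convex\<close>). Its \<open>q\<close>-th root is \<open>2^(1/2-1/q) = 2^(1/p-1/2)\<close>, the constant of the
theorem.

For \<open>p/2 \<le> 1\<close> the power function is subadditive, and no constant appears. For the spectral norm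
this follows from \<open>|A|^p \<le> L\<close> and \<open>|B|^p \<le> L\<close>, where \<open>L\<close> is the norm of \<open>|A|^p + |B|^p\<close>
(\<open>norm_stack_le_concave\<close>). For the Frobenius norm put \<open>r = p/2\<close>, and let \<open>S\<close> be \<open>A^T A\<close> or
\<open>B^T B\<close> and \<open>H\<close> their sum, so that \<open>S \<le> H\<close>. The key is \<open>tr (H^(2r-1) S) \<le> tr (H^r S^r)\<close>
(\<open>trace_powr_mult_le\<close>): the convex function \<open>\<theta> \<mapsto> tr (H^\<theta> S^(2r-\<theta>))\<close> does not decrease from
\<open>2r-2\<close> to \<open>2r-1\<close> (\<open>trace_powr_square_le\<close>), hence it does not decrease from \<open>2r-1\<close> to \<open>r\<close>.
Adding the two cases of the key inequality and applying Cauchy-Schwarz gives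
\<open>tr (H^p) \<le> tr ((|A|^p + |B|^p)^2)\<close> (\<open>trace_gram2_powr_le\<close>).

All these inequalities are proved as inequalities between finite sums over eigenbases; the existence
of an orthonormal eigenbasis of a symmetric matrix is \<open>symmetric_matrix_eigensystem\<close>.
\<close>

section \<open>Orthonormal bases and eigensystems\<close>

(* rewriting with this rule would hide the transposed matrices on which the symmetry lemmas work *)
declare transpose_matrix_vector [simp del]

text \<open>A family in \<open>real^'m\<close> that is indexed by \<open>'m\<close> has as many members as there are
coordinates, so it is then an orthonormal basis.\<close>

definition orthonormal_family :: "('i \<Rightarrow> 'a::real_inner) \<Rightarrow> bool" where
  "orthonormal_family u \<longleftrightarrow> (\<forall>i j. u i \<bullet> u j = (if i = j then 1 else 0))"

definition eigensystem :: "real^'m^'m::finite \<Rightarrow> ('m \<Rightarrow> real^'m) \<Rightarrow> ('m \<Rightarrow> real) \<Rightarrow> bool" where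
  "eigensystem M u d \<longleftrightarrow> orthonormal_family u \<and> (\<forall>i. M *v u i = d i *\<^sub>R u i)"

lemma eigensystemD:
  assumes "eigensystem M u d"
  shows "orthonormal_family u" "M *v u i = d i *\<^sub>R u i"
  using assms by (auto simp: eigensystem_def)

lemma inner_transpose_matrix:
  "x \<bullet> (transpose M *v y) = (M *v x) \<bullet> (y :: real^'m::finite)" for M :: "real^'n::finite^'m"
  by (metis dot_lmul_matrix inner_commute transpose_matrix_vector)

lemma inner_symmetric_matrix:
  fixes M :: "real^'m::finite^'m"
  assumes "transpose M = M"
  shows "x \<bullet> (M *v y) = (M *v x) \<bullet> y"
  using inner_transpose_matrix[of x M y] assms by simp

lemma orthonormal_family_matrix:
  fixes u :: "'m \<Rightarrow> real^'m::finite"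
  assumes "orthonormal_family u"
  shows "orthogonal_matrix (\<chi> i j. u j $ i)"
  using assms
  by (auto simp: orthogonal_matrix_orthonormal_columns column_def orthonormal_family_def
      norm_eq_1 orthogonal_def)

text \<open>The matrix with columns \<open>u i\<close> is orthogonal, and a left inverse of a square
matrix is a right inverse: this is where a family of the right size becomes a basis.\<close>

lemma parseval:
  fixes u :: "'m \<Rightarrow> real^'m::finite"
  assumes "orthonormal_family u"
  shows "x \<bullet> y = (\<Sum>i\<in>UNIV. (u i \<bullet> x) * (u i \<bullet> y))"
proof -
  let ?U = "\<chi> i j. u j $ i"
  have U: "?U ** transpose ?U = mat 1"
    using orthonormal_family_matrix[OF assms] by (simp add: orthogonal_matrix_def)
  have coord: "(transpose ?U *v z) $ i = u i \<bullet> z" for z i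
    by (simp add: matrix_vector_mult_def transpose_def inner_vec_def)
  have "x \<bullet> y = (?U *v (transpose ?U *v x)) \<bullet> y"
    by (simp add: matrix_vector_mul_assoc U)
  also have "\<dots> = (transpose ?U *v x) \<bullet> (transpose ?U *v y)"
    by (simp add: inner_transpose_matrix)
  finally show ?thesis by (simp add: inner_vec_def coord)
qed

lemma parseval_norm:
  fixes u :: "'m \<Rightarrow> real^'m::finite"
  assumes "orthonormal_family u"
  shows "(norm x)\<^sup>2 = (\<Sum>i\<in>UNIV. (u i \<bullet> x)\<^sup>2)"
  unfolding power2_norm_eq_inner by (simp only: power2_eq_square flip: parseval[OF assms])

lemma orthonormal_family_eqI:
  fixes u :: "'m \<Rightarrow> real^'m::finite"
  assumes "orthonormal_family u" "\<And>i. u i \<bullet> x = u i \<bullet> y"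
  shows "x = y"
proof -
  have "z \<bullet> x = z \<bullet> y" for z
    using parseval[OF assms(1), of z x] parseval[OF assms(1), of z y] assms(2) by simp
  then show ?thesis using vector_eq_ldot[of x y] by blast
qed

lemma eigensystem_inner:
  assumes "eigensystem M u d" "transpose M = M"
  shows "u i \<bullet> (M *v x) = d i * (u i \<bullet> x)"
  using inner_symmetric_matrix[OF assms(2), of "u i" x] eigensystemD(2)[OF assms(1), of i] by simp

text \<open>The maximum of the Rayleigh quotient on an invariant subspace is attained at an
eigenvector: the nonnegative form \<open>y \<bullet> (l y - M y)\<close> vanishes at the maximizer \<open>x\<close>, and
a positive semidefinite form that vanishes at \<open>x\<close> has \<open>x\<close> in its kernel.\<close>

lemma symmetric_matrix_eigenvector:
  fixes M :: "real^'m::finite^'m"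
  assumes sym: "transpose M = M" and V: "subspace V" "V \<noteq> {0}"
    and inv: "\<And>x. x \<in> V \<Longrightarrow> M *v x \<in> V"
  obtains x l where "x \<in> V" "norm x = 1" "M *v x = l *\<^sub>R x"
proof -
  (* x maximizes the Rayleigh quotient on V; then f = l - M is positive semidefinite on V *)
  let ?S = "sphere 0 1 \<inter> V"
  obtain v where v: "v \<in> V" "v \<noteq> 0" using V subspace_0 by blast
  then have "v /\<^sub>R norm v \<in> ?S" using V(1) by (auto simp: subspace_scale)
  moreover have "compact ?S" by (intro compact_Int_closed closed_subspace V(1)) simp
  moreover have "continuous_on ?S (\<lambda>x. x \<bullet> (M *v x))"
    by (intro continuous_intros matrix_vector_mult_linear_continuous_on)
  ultimately obtain x where x: "x \<in> ?S" and max: "\<And>y. y \<in> ?S \<Longrightarrow> y \<bullet> (M *v y) \<le> x \<bullet> (M *v x)"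
    using continuous_attains_sup[of ?S "\<lambda>x. x \<bullet> (M *v x)"] by blast
  define l where "l = x \<bullet> (M *v x)"
  define f where "f y = l *\<^sub>R y - M *v y" for y
  have f_nonneg: "0 \<le> y \<bullet> f y" if "y \<in> V" for y
  proof (cases "y = 0")
    case False
    have "y /\<^sub>R norm y \<in> ?S" using that False V(1) by (auto simp: subspace_scale)
    from max[OF this] False have "y \<bullet> (M *v y) \<le> l * (norm y)\<^sup>2"
      by (simp add: l_def matrix_vector_mult_scaleR field_simps power2_eq_square)
    then show ?thesis by (simp add: f_def inner_diff_right power2_norm_eq_inner)
  qed simp
  have fx: "x \<bullet> f x = 0"
    using x by (simp add: f_def l_def inner_diff_right flip: power2_norm_eq_inner)
  let ?y = "f x"
  have yV: "?y \<in> V" using x V(1) inv by (auto simp: f_def subspace_diff subspace_scale)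
  (* the minimality of x for the form of f, tested along the line through x in direction f x *)
  have quad: "0 \<le> 2 * t * (?y \<bullet> ?y) + t\<^sup>2 * (?y \<bullet> f ?y)" for t
  proof -
    have lin: "f (a + t *\<^sub>R b) = f a + t *\<^sub>R f b" for a b
      by (simp add: f_def matrix_vector_right_distrib matrix_vector_mult_scaleR algebra_simps)
    have self: "a \<bullet> f b = f a \<bullet> b" for a b
      by (simp add: f_def inner_diff_right inner_diff_left inner_symmetric_matrix[OF sym])
    have "x + t *\<^sub>R ?y \<in> V" using x yV V(1) by (auto simp: subspace_add subspace_scale)
    from f_nonneg[OF this] show ?thesis
      by (simp add: lin inner_add_left inner_add_right fx self[of x ?y] algebra_simps power2_eq_square)
  qed
  have "?y \<bullet> ?y = 0"
  proof (rule ccontr)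
    assume "?y \<bullet> ?y \<noteq> 0"
    then have "0 < ?y \<bullet> ?y" by simp
    (* any upper bound d > 0 for the quadratic coefficient serves: t = - c / d then makes the
       polynomial negative *)
    define d where "d = ?y \<bullet> f ?y + 1"
    have d: "0 < d" "?y \<bullet> f ?y \<le> d" using f_nonneg[OF yV] by (auto simp: d_def)
    define c where "c = ?y \<bullet> ?y"
    have "0 \<le> 2 * (- c / d) * c + (- c / d)\<^sup>2 * (?y \<bullet> f ?y)" using quad unfolding c_def .
    also have "\<dots> \<le> 2 * (- c / d) * c + (- c / d)\<^sup>2 * d"
      by (intro add_left_mono mult_left_mono d) simp
    also have "\<dots> = - (c\<^sup>2 / d)" using d by (simp add: field_simps power2_eq_square)
    finally show False using \<open>0 < ?y \<bullet> ?y\<close> d(1) by (simp add: c_def divide_le_0_iff)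
  qed
  then have "M *v x = l *\<^sub>R x" by (simp add: f_def)
  with x that show thesis by auto
qed

theorem symmetric_matrix_eigensystem:
  fixes M :: "real^'m::finite^'m"
  assumes sym: "transpose M = M"
  obtains u d where "eigensystem M u d"
proof -
  (* an orthonormal set of eigenvectors of largest size spans, since its orthogonal complement
     would otherwise contain a further eigenvector *)
  define good where "good E \<longleftrightarrow> pairwise orthogonal E \<and> (\<forall>x\<in>E. norm x = 1 \<and> (\<exists>l. M *v x = l *\<^sub>R x))"
    for E :: "(real^'m) set"
  have indep: "independent E" if "good E" for E
    using that by (intro pairwise_orthogonal_independent) (auto simp: good_def)
  have bound: "finite E \<and> card E \<le> CARD('m)" if "good E" for E
    using independent_bound[OF indep[OF that]] by simp
  have "good {}" by (simp add: good_def)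
  moreover have "\<forall>E. good E \<longrightarrow> card E < Suc CARD('m)" using bound by (simp add: less_Suc_eq_le)
  ultimately obtain E where E: "good E" and max: "\<And>F. good F \<Longrightarrow> card F \<le> card E"
    using ex_has_greatest_nat[of good "{}" card "Suc CARD('m)"] by metis
  define V where "V = {y. \<forall>x\<in>E. orthogonal x y}"
  have V: "subspace V" unfolding V_def by (rule subspace_orthogonal_to_vectors)
  have inv: "M *v y \<in> V" if "y \<in> V" for y
  proof -
    have "x \<bullet> (M *v y) = 0" if "x \<in> E" for x
    proof -
      obtain l where "M *v x = l *\<^sub>R x" using E \<open>x \<in> E\<close> unfolding good_def by blast
      then show ?thesis using \<open>y \<in> V\<close> that
        by (simp add: inner_symmetric_matrix[OF sym] V_def orthogonal_def)
    qed
    then show ?thesis by (simp add: V_def orthogonal_def)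
  qed
  have "V = {0}"
  proof (rule ccontr)
    assume "V \<noteq> {0}"
    then obtain x l where x: "x \<in> V" "norm x = 1" "M *v x = l *\<^sub>R x"
      using symmetric_matrix_eigenvector[OF sym V _ inv] by blast
    then have "x \<notin> E" by (auto simp: V_def orthogonal_def norm_eq_1)
    moreover have "good (insert x E)"
      using E x by (auto simp: good_def pairwise_insert V_def orthogonal_commute)
    ultimately show False using max[of "insert x E"] bound[OF E] by simp
  qed
  have "span E = UNIV"
  proof (rule ccontr)
    assume "span E \<noteq> UNIV"
    then obtain a where "a \<noteq> 0" "\<And>x. x \<in> span E \<Longrightarrow> orthogonal a x"
      using orthogonal_to_subspace_exists_gen[of E UNIV] by (auto simp: psubset_eq)
    then have "a \<in> V" by (auto simp: V_def orthogonal_commute span_base)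
    then show False using \<open>a \<noteq> 0\<close> \<open>V = {0}\<close> by simp
  qed
  then have "card E = CARD('m)"
    using dim_eq_card_independent[OF indep[OF E]] dim_span[of E] by simp
  then obtain u where u: "bij_betw u (UNIV :: 'm set) E"
    using bound[OF E] finite_same_card_bij[of "UNIV :: 'm set" E] by auto
  have uE: "u i \<in> E" for i using u by (auto simp: bij_betw_def)
  have "\<exists>l. M *v u i = l *\<^sub>R u i" for i using E uE by (auto simp: good_def)
  then obtain d where "\<And>i. M *v u i = d i *\<^sub>R u i" by metis
  moreover have "orthonormal_family u"
    unfolding orthonormal_family_def
  proof (intro allI)
    fix i j
    have "u i \<noteq> u j" if "i \<noteq> j" using u that by (auto simp: bij_betw_def inj_eq)
    then show "u i \<bullet> u j = (if i = j then 1 else 0)"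
      using E uE[of i] uE[of j] by (auto simp: good_def pairwise_def orthogonal_def norm_eq_1)
  qed
  ultimately show thesis using that by (auto simp: eigensystem_def)
qed

text \<open>Translates between eigensystems, which suit computations with sums over
eigenvectors, and the factorization by orthogonal matrices in the definition of the
power of a matrix.\<close>

lemma eigensystem_iff_diagonalization:
  "eigensystem M u d \<and> transpose M = M \<longleftrightarrow> orthogonal_matrix (\<chi> i j. u j $ i) \<and>
     M = (\<chi> i j. u j $ i) ** diag_matrix (\<chi> i. d i) ** transpose (\<chi> i j. u j $ i)"
  (is "?l \<longleftrightarrow> orthogonal_matrix ?U \<and> M = ?D")
proof -
  have D_sym: "transpose ?D = ?D"
  proof -
    have "transpose (diag_matrix (\<chi> i. d i)) = diag_matrix (\<chi> i. d i)"
      by (auto simp: diag_matrix_def transpose_def vec_eq_iff)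
    then show ?thesis by (simp add: matrix_transpose_mul matrix_mul_assoc)
  qed
  have coord: "transpose ?U *v x = (\<chi> i. u i \<bullet> x)" for x
    by (simp add: matrix_vector_mult_def transpose_def inner_vec_def vec_eq_iff)
  have diag: "diag_matrix (\<chi> i. d i) *v x = (\<chi> i. d i * x $ i)" for x
    by (simp add: diag_matrix_def matrix_vector_mult_def vec_eq_iff if_distrib[of "\<lambda>a. a * _"]
        cong: if_cong)
  have comb: "?U *v x = (\<Sum>i\<in>UNIV. x $ i *\<^sub>R u i)" for x
    by (simp add: matrix_vector_mult_def vec_eq_iff mult.commute)
  have D: "?D *v x = (\<Sum>i\<in>UNIV. (d i * (u i \<bullet> x)) *\<^sub>R u i)" for x
    by (simp add: matrix_vector_mul_assoc[symmetric] coord diag comb)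
  have D_eig: "eigensystem ?D u d" if "orthonormal_family u"
    using that by (auto simp: eigensystem_def orthonormal_family_def D if_distrib[of "\<lambda>a. _ * a"]
      if_distrib[of "\<lambda>a. a *\<^sub>R _"] cong: if_cong)
  have onf: "orthogonal_matrix ?U \<longleftrightarrow> orthonormal_family u"
    unfolding orthogonal_matrix_orthonormal_columns column_def orthonormal_family_def
    by (auto simp: norm_eq_1 orthogonal_def)
  show ?thesis
  proof
    assume l: ?l
    then have o: "orthonormal_family u" by (simp add: eigensystem_def)
    have "u i \<bullet> (M *v x) = u i \<bullet> (?D *v x)" for i x
      using eigensystem_inner[of M u d i x] eigensystem_inner[OF D_eig[OF o] D_sym, of i x] l by metis
    then have "M *v x = ?D *v x" for x by (rule orthonormal_family_eqI[OF o])
    then have "M = ?D" by (simp add: matrix_eq)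
    then show "orthogonal_matrix ?U \<and> M = ?D" using onf o by blast
  next
    assume r: "orthogonal_matrix ?U \<and> M = ?D"
    then show ?l using D_sym D_eig onf by metis
  qed
qed

section \<open>Powers of positive semidefinite matrices and tensors\<close>

text \<open>Eigenvectors of \<open>M\<close> for different eigenvalues are orthogonal, so \<open>u i\<close> and \<open>v j\<close>
either are orthogonal or have equal eigenvalues \<open>d i = e j\<close>, hence equal powers of
these. This makes the power of a matrix well defined.\<close>

lemma eigensystem_unique_powr:
  assumes "eigensystem M u d" "eigensystem M v e" "transpose M = M"
    "eigensystem P u (\<lambda>i. d i powr r)" "transpose P = P"
    "eigensystem Q v (\<lambda>i. e i powr r)" "transpose Q = Q"
  shows "P = Q"
proof -
  have "P *v v j = Q *v v j" for j
  proof (rule orthonormal_family_eqI[OF eigensystemD(1)[OF assms(1)]])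
    fix i
    have "d i * (u i \<bullet> v j) = u i \<bullet> (M *v v j)"
      by (simp only: eigensystem_inner[OF assms(1,3)])
    also have "\<dots> = e j * (u i \<bullet> v j)" by (simp add: eigensystemD(2)[OF assms(2)])
    finally have "d i powr r * (u i \<bullet> v j) = e j powr r * (u i \<bullet> v j)" by auto
    then show "u i \<bullet> (P *v v j) = u i \<bullet> (Q *v v j)"
      using eigensystem_inner[OF assms(4,5), of i "v j"] eigensystemD(2)[OF assms(6), of j] by simp
  qed
  then have "v j \<bullet> (P *v x) = v j \<bullet> (Q *v x)" for j x
    by (metis inner_symmetric_matrix assms(5,7))
  then have "P *v x = Q *v x" for x
    by (intro orthonormal_family_eqI[OF eigensystemD(1)[OF assms(2)]])
  then show ?thesis by (simp add: matrix_eq)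
qed

lemma psd_matrix_powr_eqI:
  fixes M P :: "real^'m::finite^'m"
  assumes "eigensystem M u d" "transpose M = M" "\<And>i. 0 \<le> d i"
    "eigensystem P u (\<lambda>i. d i powr r)" "transpose P = P"
  shows "psd_matrix_powr M r = P"
  unfolding psd_matrix_powr_def
proof (rule the_equality)
  let ?U = "\<chi> i j. u j $ i"
  show "\<exists>U d. orthogonal_matrix U \<and> (\<forall>i. 0 \<le> d $ i) \<and> M = U ** diag_matrix d ** transpose U \<and>
    P = U ** diag_matrix (\<chi> i. d $ i powr r) ** transpose U"
    using eigensystem_iff_diagonalization[of M u d] eigensystem_iff_diagonalization[of P u "\<lambda>i. d i powr r"] assms
    by (intro exI[of _ ?U] exI[of _ "\<chi> i. d i"]) simp
next
  fix Q assume "\<exists>U d. orthogonal_matrix U \<and> (\<forall>i. 0 \<le> d $ i) \<and> M = U ** diag_matrix d ** transpose U \<and>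
    Q = U ** diag_matrix (\<chi> i. d $ i powr r) ** transpose U"
  then obtain U :: "real^'m^'m" and e where U: "orthogonal_matrix U" "M = U ** diag_matrix e ** transpose U"
    "Q = U ** diag_matrix (\<chi> i. e $ i powr r) ** transpose U" by blast
  define v where "v j = (\<chi> i. U $ i $ j)" for j
  have v: "(\<chi> i j. v j $ i) = U" by (simp add: v_def vec_eq_iff)
  have "eigensystem M v (($) e) \<and> transpose M = M"
    unfolding eigensystem_iff_diagonalization v using U by simp
  moreover have "eigensystem Q v (\<lambda>i. e $ i powr r) \<and> transpose Q = Q"
    unfolding eigensystem_iff_diagonalization v using U by simp
  ultimately show "Q = P" using eigensystem_unique_powr[OF assms(1) _ assms(2,4,5)] by metis
qed

lemma exists_matrix_eigensystem:
  fixes u :: "'m \<Rightarrow> real^'m::finite"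
  assumes "orthonormal_family u"
  obtains P where "eigensystem P u d" "transpose P = P"
  using eigensystem_iff_diagonalization[of _ u d] orthonormal_family_matrix[OF assms] by blast

lemma psd_matrix_powr_eigensystem:
  assumes "eigensystem M u d" "transpose M = M" "\<And>i. 0 \<le> d i"
  shows "eigensystem (psd_matrix_powr M r) u (\<lambda>i. d i powr r)"
    and "transpose (psd_matrix_powr M r) = psd_matrix_powr M r"
proof -
  obtain P where P: "eigensystem P u (\<lambda>i. d i powr r)" "transpose P = P"
    using exists_matrix_eigensystem[OF eigensystemD(1)[OF assms(1)]] .
  with psd_matrix_powr_eqI[OF assms P] show "eigensystem (psd_matrix_powr M r) u (\<lambda>i. d i powr r)"
    "transpose (psd_matrix_powr M r) = psd_matrix_powr M r" by auto
qed

text \<open>A symmetry of \<open>M\<close> under simultaneous permutation of rows and columns carries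
over to its powers, because the permuted eigenvectors are again a diagonalization of
\<open>M\<close> and the power does not depend on the diagonalization.\<close>

lemma psd_matrix_powr_reindex:
  fixes M :: "real^'m::finite^'m"
  assumes M: "eigensystem M u d" "transpose M = M" "\<And>i. 0 \<le> d i" and pi: "bij \<pi>"
    and inv: "\<And>i j. M $ \<pi> i $ \<pi> j = M $ i $ j"
  shows "psd_matrix_powr M r $ \<pi> i $ \<pi> j = psd_matrix_powr M r $ i $ j"
proof -
  (* conjugation by the permutation maps eigensystems to eigensystems *)
  define shift where "shift P = (\<chi> i j. P $ \<pi> i $ \<pi> j)" for P :: "real^'m^'m"
  define v where "v j = (\<chi> i. u j $ \<pi> i)" for j
  have v_inner: "v i \<bullet> v j = u i \<bullet> u j" for i j
    unfolding v_def inner_vec_def by (simp add: sum.reindex_bij_betw[OF pi, of "\<lambda>k. u i $ k * u j $ k"])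
  have mult: "(shift P *v v j) $ i = (P *v u j) $ \<pi> i" for P i j
    unfolding shift_def v_def matrix_vector_mult_def
    by (simp add: sum.reindex_bij_betw[OF pi, of "\<lambda>k. P $ \<pi> i $ k * u j $ k"])
  have eig: "eigensystem (shift P) v e" if "eigensystem P u e" for P e
    using that by (simp add: eigensystem_def orthonormal_family_def v_inner vec_eq_iff mult)
      (simp add: v_def)
  have sym: "transpose (shift P) = shift P" if "transpose P = P" for P
    using that by (simp add: shift_def transpose_def vec_eq_iff)
  note pow = psd_matrix_powr_eigensystem[OF M, of r]
  have "shift M = M" by (simp add: shift_def inv vec_eq_iff)
  then have "shift (psd_matrix_powr M r) = psd_matrix_powr M r"
    using psd_matrix_powr_eqI[OF _ M(2,3) eig[OF pow(1)] sym[OF pow(2)]] eig[OF M(1)] by simp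
  then have "shift (psd_matrix_powr M r) $ i $ j = psd_matrix_powr M r $ i $ j" by simp
  then show ?thesis by (simp add: shift_def)
qed

text \<open>The block circulant matrices are those invariant under translation of the block
indices. By invariance the power of a block circulant matrix is again one, so the
tensor power exists.\<close>

lemma bcirc_tpowr:
  fixes A :: "('n::finite, 'n, 'k::{finite,linorder}) tensor"
  assumes M: "eigensystem (bcirc A) u d" "transpose (bcirc A) = bcirc A" "\<And>i. 0 \<le> d i"
  shows "bcirc (tpowr A r) = psd_matrix_powr (bcirc A) r"
proof -
  let ?P = "psd_matrix_powr (bcirc A) r"
  (* translating both block indices is a symmetry of a block circulant matrix *)
  have inv: "?P $ (slice_diff k m, i) $ (slice_diff l m, j) = ?P $ (k, i) $ (l, j)" for k l m i j
  proof -
    have "bij (map_prod (\<lambda>l. slice_diff l m) id)"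
      using bij_slice_diff[of m] by (simp add: bij_def prod.inj_map map_prod_surj)
    from psd_matrix_powr_reindex[OF M this, of r "(k, i)" "(l, j)"] show ?thesis
      by (simp add: bcirc_def slice_diff_diff)
  qed
  have first: "slice_diff l l = first_slice" for l :: 'k
  proof -
    have "int (slice_no (slice_diff l l)) = int (slice_no (first_slice :: 'k))"
      by (simp add: slice_no_diff)
    then show ?thesis by (simp only: of_nat_eq_iff inj_eq[OF inj_slice_no])
  qed
  have "?P $ (slice_diff k l, i) $ (first_slice, j) = ?P $ (k, i) $ (l, j)" for k l i j
    using inv[of k l i l j] by (simp only: first)
  then have T: "bcirc (\<chi> k i j. ?P $ (k, i) $ (first_slice, j)) = ?P"
    by (simp add: bcirc_def vec_eq_iff split_paired_all)
  then have "tpowr A r = (\<chi> k i j. ?P $ (k, i) $ (first_slice, j))"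
    unfolding tpowr_def by (intro the_equality) (simp_all flip: bcirc_inject)
  with T show ?thesis by simp
qed

lemma gram_symmetric: "transpose (transpose X ** X) = transpose X ** (X :: real^'n::finite^'m::finite)"
  by (simp add: matrix_transpose_mul)

lemma gram_eigenvalue:
  fixes X :: "real^'m::finite^'m"
  assumes "eigensystem (transpose X ** X) u d"
  shows "d i = (norm (X *v u i))\<^sup>2"
proof -
  have "(norm (X *v u i))\<^sup>2 = u i \<bullet> (transpose X *v (X *v u i))"
    by (simp add: inner_transpose_matrix power2_norm_eq_inner)
  also have "\<dots> = d i"
    using eigensystemD[OF assms]
    by (simp add: matrix_vector_mul_assoc orthonormal_family_def)
  finally show ?thesis by simp
qed

text \<open>The exponent is \<open>p/2\<close> because \<open>|A|^p\<close> is the power \<open>p\<close> of the power \<open>1/2\<close> of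
\<open>A^T A\<close>.\<close>

lemma bcirc_tabs_powr:
  assumes u: "eigensystem (transpose (bcirc A) ** bcirc A) u s"
  shows "eigensystem (bcirc (tpowr (tabs A) p)) u (\<lambda>i. s i powr (p / 2))"
    and "transpose (bcirc (tpowr (tabs A) p)) = bcirc (tpowr (tabs A) p)"
proof -
  have s: "0 \<le> s i" for i using gram_eigenvalue[OF u] by simp
  have u': "eigensystem (bcirc (ttranspose A \<star> A)) u s"
    using u by (simp add: bcirc_tprod bcirc_ttranspose)
  have sym: "transpose (bcirc (ttranspose A \<star> A)) = bcirc (ttranspose A \<star> A)"
    by (simp add: bcirc_tprod bcirc_ttranspose gram_symmetric)
  note a = psd_matrix_powr_eigensystem[OF u' sym s, of "1/2", folded bcirc_tpowr[OF u' sym s] tabs_def]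
  note b = psd_matrix_powr_eigensystem[OF a powr_ge_zero, of p, folded bcirc_tpowr[OF a powr_ge_zero]]
  show "eigensystem (bcirc (tpowr (tabs A) p)) u (\<lambda>i. s i powr (p / 2))"
    using b(1) by (simp add: powr_powr)
  show "transpose (bcirc (tpowr (tabs A) p)) = bcirc (tpowr (tabs A) p)" by (rule b(2))
qed

section \<open>Bessel and Hoelder inequalities for orthogonal families\<close>

lemma norm_matrix_orthonormal:
  fixes M :: "real^'m::finite^'m" and u :: "'m \<Rightarrow> real^'m"
  assumes "orthonormal_family u"
  shows "(norm M)\<^sup>2 = (\<Sum>i\<in>UNIV. (norm (M *v u i))\<^sup>2)"
proof -
  have "(norm M)\<^sup>2 = (\<Sum>k\<in>UNIV. (norm (M $ k))\<^sup>2)"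
    unfolding power2_norm_eq_inner by (simp add: inner_vec_def[of M])
  also have "\<dots> = (\<Sum>k\<in>UNIV. \<Sum>i\<in>UNIV. (u i \<bullet> M $ k)\<^sup>2)"
    by (simp only: parseval_norm[OF assms])
  also have "\<dots> = (\<Sum>i\<in>UNIV. \<Sum>k\<in>UNIV. (u i \<bullet> M $ k)\<^sup>2)"
    by (rule sum.swap)
  also have "\<dots> = (\<Sum>i\<in>UNIV. (norm (M *v u i))\<^sup>2)"
    unfolding power2_norm_eq_inner
    by (simp add: inner_vec_def[of "M *v _"] matrix_vector_mul_component inner_commute power2_eq_square)
  finally show ?thesis .
qed

lemma sum_diagonal_squares_le:
  fixes M :: "real^'m::finite^'m" and u :: "'m \<Rightarrow> real^'m"
  assumes "orthonormal_family u"
  shows "(\<Sum>i\<in>UNIV. (u i \<bullet> (M *v u i))\<^sup>2) \<le> (norm M)\<^sup>2"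
  unfolding norm_matrix_orthonormal[OF assms]
proof (rule sum_mono)
  fix i
  have "(u i \<bullet> (M *v u i))\<^sup>2 \<le> (u i \<bullet> u i) * ((M *v u i) \<bullet> (M *v u i))"
    by (rule Cauchy_Schwarz_ineq)
  then show "(u i \<bullet> (M *v u i))\<^sup>2 \<le> (norm (M *v u i))\<^sup>2"
    using assms by (simp add: orthonormal_family_def power2_norm_eq_inner)
qed

text \<open>The left side is \<open>z \<bullet> z\<close> for the orthogonal projection \<open>z\<close> of \<open>x\<close> to the span of
the family. A vanishing \<open>y i\<close> contributes 0, as division by zero gives 0.\<close>

lemma bessel:
  fixes y :: "'i \<Rightarrow> 'a::real_inner"
  assumes "finite I" "\<And>i j. i \<in> I \<Longrightarrow> j \<in> I \<Longrightarrow> i \<noteq> j \<Longrightarrow> y i \<bullet> y j = 0"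
  shows "(\<Sum>i\<in>I. (y i \<bullet> x)\<^sup>2 / (y i \<bullet> y i)) \<le> x \<bullet> x"
proof -
  define c where "c i = (y i \<bullet> x) / (y i \<bullet> y i)" for i
  define z where "z = (\<Sum>i\<in>I. c i *\<^sub>R y i)"
  let ?b = "\<Sum>i\<in>I. (y i \<bullet> x)\<^sup>2 / (y i \<bullet> y i)"
  have zx: "z \<bullet> x = ?b"
    by (simp add: z_def c_def inner_sum_left power2_eq_square)
  have zy: "z \<bullet> y i = c i * (y i \<bullet> y i)" if "i \<in> I" for i
  proof -
    have "z \<bullet> y i = (\<Sum>j\<in>I. if j = i then c i * (y i \<bullet> y i) else 0)"
      unfolding z_def inner_sum_left by (rule sum.cong) (auto simp: assms(2) that)
    then show ?thesis using that assms(1) by simp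
  qed
  have "z \<bullet> z = (\<Sum>i\<in>I. c i * (z \<bullet> y i))"
    by (subst (2) z_def) (simp add: inner_sum_right)
  also have "\<dots> = ?b"
    by (rule sum.cong) (auto simp: zy c_def power2_eq_square)
  finally have zz: "z \<bullet> z = ?b" .
  have "0 \<le> (x - z) \<bullet> (x - z)" by simp
  also have "\<dots> = x \<bullet> x - ?b"
    using zx zz by (simp add: inner_diff_left inner_diff_right inner_commute)
  finally show ?thesis by simp
qed

text \<open>The case of exponents \<open>1\<close> and \<open>\<infinity>\<close>: Bessel's inequality for the family \<open>y\<close>,
applied to each \<open>x j\<close>.\<close>

lemma orthogonal_families_bound:
  fixes x :: "'j::finite \<Rightarrow> 'a::real_inner" and y :: "'i::finite \<Rightarrow> 'a"
  assumes y: "\<And>i j. i \<noteq> j \<Longrightarrow> y i \<bullet> y j = 0" and b: "\<And>i. y i \<bullet> y i \<le> b"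
  shows "(\<Sum>j\<in>UNIV. \<Sum>i\<in>UNIV. (y i \<bullet> x j)\<^sup>2) \<le> b * (\<Sum>j\<in>UNIV. x j \<bullet> x j)"
  unfolding sum_distrib_left
proof (rule sum_mono)
  fix j
  have b0: "0 \<le> b" using b[of undefined] inner_ge_zero order_trans by blast
  have "(\<Sum>i\<in>UNIV. (y i \<bullet> x j)\<^sup>2) \<le> (\<Sum>i\<in>UNIV. b * ((y i \<bullet> x j)\<^sup>2 / (y i \<bullet> y i)))"
  proof (rule sum_mono)
    fix i
    show "(y i \<bullet> x j)\<^sup>2 \<le> b * ((y i \<bullet> x j)\<^sup>2 / (y i \<bullet> y i))"
    proof (cases "y i = 0")
      case False
      then have "0 < y i \<bullet> y i" by simp
      then show ?thesis using mult_right_mono[OF b[of i], of "(y i \<bullet> x j)\<^sup>2"] by (simp add: field_simps)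
    qed simp
  qed
  also have "\<dots> \<le> b * (x j \<bullet> x j)"
    unfolding sum_distrib_left[symmetric] by (intro mult_left_mono bessel b0 y) auto
  finally show "(\<Sum>i\<in>UNIV. (y i \<bullet> x j)\<^sup>2) \<le> b * (x j \<bullet> x j)" .
qed

text \<open>Hoelder's inequality for a doubly substochastic weight: after normalization of
\<open>a\<close> and \<open>b\<close>, Young's inequality is applied to each term, and the row and column sums
of the weight are bounded by 1.\<close>

lemma weighted_holder:
  fixes a :: "'j::finite \<Rightarrow> real" and b :: "'i::finite \<Rightarrow> real"
  assumes pq: "1 < p" "1 < q" "1 / p + 1 / q = 1"
    and nonneg: "\<And>j. 0 \<le> a j" "\<And>i. 0 \<le> b i" "\<And>i j. 0 \<le> w i j"
    and rows: "\<And>i. (\<Sum>j\<in>UNIV. w i j) \<le> 1" and cols: "\<And>j. (\<Sum>i\<in>UNIV. w i j) \<le> 1"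
  shows "(\<Sum>j\<in>UNIV. \<Sum>i\<in>UNIV. a j * b i * w i j)
    \<le> (\<Sum>j\<in>UNIV. a j powr p) powr (1 / p) * (\<Sum>i\<in>UNIV. b i powr q) powr (1 / q)"
proof -
  define X where "X = (\<Sum>j\<in>UNIV. a j powr p) powr (1 / p)"
  define Y where "Y = (\<Sum>i\<in>UNIV. b i powr q) powr (1 / q)"
  have X0: "0 \<le> X" and Y0: "0 \<le> Y" by (simp_all add: X_def Y_def)
  show ?thesis
  proof (cases "X = 0 \<or> Y = 0")
    case True
    then have "(\<forall>j. a j = 0) \<or> (\<forall>i. b i = 0)"
      by (auto simp: X_def Y_def sum_nonneg_eq_0_iff)
    then show ?thesis by (auto simp: sum_nonneg)
  next
    case False
    with X0 Y0 have X: "0 < X" and Y: "0 < Y" by auto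
    have Xp: "(\<Sum>j\<in>UNIV. (a j / X) powr p) = 1"
    proof -
      have "X powr p = (\<Sum>j\<in>UNIV. a j powr p)"
        using pq by (simp add: X_def powr_powr sum_nonneg)
      moreover have "0 < X powr p" using X by simp
      ultimately show ?thesis by (simp add: powr_divide flip: sum_divide_distrib)
    qed
    have Yq: "(\<Sum>i\<in>UNIV. (b i / Y) powr q) = 1"
    proof -
      have "Y powr q = (\<Sum>i\<in>UNIV. b i powr q)"
        using pq by (simp add: Y_def powr_powr sum_nonneg)
      moreover have "0 < Y powr q" using Y by simp
      ultimately show ?thesis by (simp add: powr_divide flip: sum_divide_distrib)
    qed
    have "(\<Sum>j\<in>UNIV. \<Sum>i\<in>UNIV. (a j / X) * (b i / Y) * w i j)
      \<le> (\<Sum>j\<in>UNIV. \<Sum>i\<in>UNIV. ((a j / X) powr p / p + (b i / Y) powr q / q) * w i j)"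
      using X Y nonneg pq by (intro sum_mono mult_right_mono Youngs_inequality) auto
    also have "\<dots> = (\<Sum>j\<in>UNIV. (a j / X) powr p / p * (\<Sum>i\<in>UNIV. w i j))
        + (\<Sum>i\<in>UNIV. (b i / Y) powr q / q * (\<Sum>j\<in>UNIV. w i j))"
      unfolding sum_distrib_left distrib_right sum.distrib
      by (subst (3) sum.swap) simp
    also have "\<dots> \<le> (\<Sum>j\<in>UNIV. (a j / X) powr p / p * 1) + (\<Sum>i\<in>UNIV. (b i / Y) powr q / q * 1)"
      using pq by (intro add_mono sum_mono mult_left_mono rows cols) auto
    also have "\<dots> = 1"
      using Xp Yq pq by (simp flip: sum_divide_distrib)
    finally have "(\<Sum>j\<in>UNIV. \<Sum>i\<in>UNIV. (a j / X) * (b i / Y) * w i j) \<le> 1" .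
    moreover have "(\<Sum>j\<in>UNIV. \<Sum>i\<in>UNIV. (a j / X) * (b i / Y) * w i j)
        = (\<Sum>j\<in>UNIV. \<Sum>i\<in>UNIV. a j * b i * w i j) / (X * Y)"
      by (simp add: sum_divide_distrib)
    ultimately have "(\<Sum>j\<in>UNIV. \<Sum>i\<in>UNIV. a j * b i * w i j) / (X * Y) \<le> 1" by simp
    then show ?thesis using X Y by (simp add: X_def[symmetric] Y_def[symmetric] pos_divide_le_eq)
  qed
qed

text \<open>By Bessel's inequality for both families, the squared cosines of the angles
between \<open>y i\<close> and \<open>x j\<close> form a doubly substochastic matrix. Applied to the images of
eigenvectors, this is Hoelder's inequality for Schatten norms.\<close>

lemma orthogonal_families_holder:
  fixes x :: "'j::finite \<Rightarrow> 'a::real_inner" and y :: "'i::finite \<Rightarrow> 'a"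
  assumes pq: "1 < p" "1 < q" "1 / p + 1 / q = 1"
    and x: "\<And>i j. i \<noteq> j \<Longrightarrow> x i \<bullet> x j = 0" and y: "\<And>i j. i \<noteq> j \<Longrightarrow> y i \<bullet> y j = 0"
  shows "(\<Sum>j\<in>UNIV. \<Sum>i\<in>UNIV. (y i \<bullet> x j)\<^sup>2)
    \<le> (\<Sum>j\<in>UNIV. (x j \<bullet> x j) powr p) powr (1 / p) * (\<Sum>i\<in>UNIV. (y i \<bullet> y i) powr q) powr (1 / q)"
proof -
  (* squared cosines; a vanishing vector contributes 0 because division by zero gives 0 *)
  define w where "w i j = (y i \<bullet> x j)\<^sup>2 / (y i \<bullet> y i) / (x j \<bullet> x j)" for i j
  have cols: "(\<Sum>i\<in>UNIV. w i j) \<le> 1" for j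
  proof (cases "x j = 0")
    case False
    then have "0 < x j \<bullet> x j" by simp
    then show ?thesis using bessel[of UNIV y "x j"] y
      unfolding w_def sum_divide_distrib[symmetric] by (simp del: inner_gt_zero_iff)
  qed (simp add: w_def)
  have rows: "(\<Sum>j\<in>UNIV. w i j) \<le> 1" for i
  proof (cases "y i = 0")
    case False
    then have "0 < y i \<bullet> y i" by simp
    moreover have "(\<Sum>j\<in>UNIV. w i j) = (\<Sum>j\<in>UNIV. (x j \<bullet> y i)\<^sup>2 / (x j \<bullet> x j)) / (y i \<bullet> y i)"
      by (simp add: w_def sum_divide_distrib inner_commute mult.commute)
    ultimately show ?thesis using bessel[of UNIV x "y i"] x by (simp del: inner_gt_zero_iff)
  qed (simp add: w_def)
  have "(y i \<bullet> x j)\<^sup>2 = (x j \<bullet> x j) * (y i \<bullet> y i) * w i j" for i j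
    by (cases "x j = 0"; cases "y i = 0") (simp_all add: w_def)
  then have "(\<Sum>j\<in>UNIV. \<Sum>i\<in>UNIV. (y i \<bullet> x j)\<^sup>2)
      = (\<Sum>j\<in>UNIV. \<Sum>i\<in>UNIV. (x j \<bullet> x j) * (y i \<bullet> y i) * w i j)" by simp
  also have "\<dots> \<le> (\<Sum>j\<in>UNIV. (x j \<bullet> x j) powr p) powr (1 / p)
      * (\<Sum>i\<in>UNIV. (y i \<bullet> y i) powr q) powr (1 / q)"
    by (rule weighted_holder[OF pq _ _ _ rows cols]) (auto simp: w_def)
  finally show ?thesis .
qed

section \<open>Scalar inequalities for real powers\<close>

text \<open>The graph of the convex power function lies above its tangent at \<open>c\<close>. With
\<open>t = s / c\<close> this is Bernoulli's inequality, which is Young's inequality for \<open>t^r\<close> and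
\<open>1\<close>.\<close>

lemma powr_ge_tangent:
  assumes "1 \<le> r" "0 \<le> s" "0 < (c::real)"
  shows "c powr r + r * c powr (r - 1) * (s - c) \<le> s powr r"
proof (cases "s = 0")
  case True
  then show ?thesis using assms by (simp add: powr_diff algebra_simps mult_right_mono[of 1 r])
next
  case False
  define t where "t = s / c"
  have t: "0 < t" using False assms by (simp add: t_def)
  have "(t powr r) powr (1 / r) * 1 powr (1 - 1 / r) \<le> 1 / r * t powr r + (1 - 1 / r) * 1"
    using assms t by (intro Youngs_inequality_0) auto
  then have "r * t \<le> r * (1 / r * t powr r + (1 - 1 / r))"
    using assms t by (intro mult_left_mono) (simp_all add: powr_powr)
  then have "1 + r * (t - 1) \<le> t powr r"
    using assms by (simp add: algebra_simps)
  then have "c powr r * (1 + r * (t - 1)) \<le> c powr r * t powr r"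
    by (intro mult_left_mono) auto
  then show ?thesis using assms by (simp add: t_def powr_divide powr_diff field_simps)
qed

text \<open>The tangent at 1 of the convex function with exponent \<open>-m\<close>. Here Young's
inequality is applied to \<open>t^(-m)\<close> and \<open>t\<close>, with weights for which the product is 1.\<close>

lemma powr_tangent_neg:
  assumes "0 \<le> m" "0 < (t::real)"
  shows "1 - m * (t - 1) \<le> t powr (- m)"
proof -
  have "(t powr (- m)) powr (1 / (1 + m)) * t powr (m / (1 + m))
      \<le> 1 / (1 + m) * t powr (- m) + m / (1 + m) * t"
    using assms by (intro Youngs_inequality_0) (auto simp: field_simps)
  also have "(t powr (- m)) powr (1 / (1 + m)) * t powr (m / (1 + m)) = 1"
    using assms by (simp add: powr_powr flip: powr_add)
  finally have "1 \<le> (t powr (- m) + m * t) / (1 + m)" by (simp add: add_divide_distrib)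
  then show ?thesis using assms by (simp add: algebra_simps)
qed

text \<open>Convexity at the midpoint: the tangent terms at \<open>s\<close> and \<open>t\<close> cancel.\<close>

lemma powr_add_le:
  assumes "1 \<le> r" "0 \<le> s" "0 \<le> (t::real)"
  shows "(s + t) powr r \<le> 2 powr (r - 1) * (s powr r + t powr r)"
proof (cases "s + t = 0")
  case False
  define c where "c = (s + t) / 2"
  have c: "0 < c" using assms False by (auto simp: c_def)
  have "t - c = - (s - c)" by (simp add: c_def field_simps)
  then have "r * c powr (r - 1) * (t - c) = - (r * c powr (r - 1) * (s - c))"
    by (simp only: mult_minus_right)
  then have "2 * c powr r \<le> s powr r + t powr r"
    using powr_ge_tangent[OF assms(1,2) c] powr_ge_tangent[OF assms(1,3) c] by linarith
  then have "2 powr (r - 1) * (2 * c powr r) \<le> 2 powr (r - 1) * (s powr r + t powr r)"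
    by (intro mult_left_mono) auto
  then show ?thesis by (simp add: c_def powr_divide powr_diff)
qed (use assms in auto)

section \<open>Trace inequalities for powers of ordered matrices\<close>

lemma eigensystem_quadratic_form:
  fixes S :: "real^'m::finite^'m"
  assumes "eigensystem S u s" "transpose S = S"
  shows "x \<bullet> (S *v x) = (\<Sum>i\<in>UNIV. s i * (u i \<bullet> x)\<^sup>2)"
  using parseval[OF eigensystemD(1)[OF assms(1)], of x "S *v x"]
  by (simp add: eigensystem_inner[OF assms] power2_eq_square mult_ac)

text \<open>Jensen's inequality: the squared coordinates of the unit vector \<open>x\<close> in the
eigenbasis are the weights, and \<open>x \<bullet> S x\<close> is the mean of the eigenvalues.\<close>

lemma quadratic_form_powr_le:
  fixes S :: "real^'m::finite^'m"
  assumes S: "eigensystem S u s" "transpose S = S" "\<And>i. 0 \<le> s i"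
    and P: "eigensystem P u (\<lambda>i. s i powr r)" "transpose P = P"
    and "1 \<le> r" "norm x = 1"
  shows "(x \<bullet> (S *v x)) powr r \<le> x \<bullet> (P *v x)"
proof -
  define w where "w i = (u i \<bullet> x)\<^sup>2" for i
  have w: "0 \<le> w i" "(\<Sum>i\<in>UNIV. w i) = 1" for i
    using parseval_norm[OF eigensystemD(1)[OF S(1)], of x] assms(7) by (auto simp: w_def)
  define c where "c = (\<Sum>i\<in>UNIV. s i * w i)"
  have c0: "0 \<le> c" using S(3) w by (simp add: c_def sum_nonneg)
  have "c powr r \<le> (\<Sum>i\<in>UNIV. s i powr r * w i)"
  proof (cases "c = 0")
    case False
    have "c powr r = (\<Sum>i\<in>UNIV. (c powr r + r * c powr (r - 1) * (s i - c)) * w i)"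
    proof -
      have "(\<Sum>i\<in>UNIV. (c powr r + r * c powr (r - 1) * (s i - c)) * w i)
        = (\<Sum>i\<in>UNIV. (c powr r - r * c powr (r - 1) * c) * w i + r * c powr (r - 1) * (s i * w i))"
        by (rule sum.cong) (auto simp: algebra_simps)
      also have "\<dots> = (c powr r - r * c powr (r - 1) * c) * (\<Sum>i\<in>UNIV. w i) + r * c powr (r - 1) * c"
        by (simp add: sum.distrib c_def flip: sum_distrib_left)
      finally show ?thesis by (simp add: w)
    qed
    also have "\<dots> \<le> (\<Sum>i\<in>UNIV. s i powr r * w i)"
      using False c0 w assms by (intro sum_mono mult_right_mono powr_ge_tangent) auto
    finally show ?thesis .
  qed (simp add: w sum_nonneg)
  then show ?thesis
    by (simp add: eigensystem_quadratic_form[OF S(1,2)] eigensystem_quadratic_form[OF P] c_def w_def)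
qed

text \<open>After multiplication by \<open>x * y\<close> this is the rearrangement inequality for the
equally ordered pairs \<open>x, y\<close> and \<open>x^a, y^a\<close>.\<close>

lemma powr_exchange_le:
  assumes "0 < x" "0 < (y::real)" "0 \<le> a"
  shows "x powr (a - 1) + y powr (a - 1) \<le> x powr a / y + y powr a / x"
proof -
  have "0 \<le> (x powr a - y powr a) * (x - y)"
    using assms powr_mono2[of a x y] powr_mono2[of a y x]
    by (cases "x \<le> y") (simp_all add: mult_nonneg_nonneg mult_nonpos_nonpos)
  then have "0 \<le> (x powr a - y powr a) * (x - y) / (x * y)" using assms by simp
  also have "\<dots> = x powr a / y + y powr a / x - (x powr a / x + y powr a / y)"
    using assms by (simp add: field_simps)
  finally show ?thesis using assms by (simp add: powr_diff)
qed

text \<open>The hypothesis is \<open>S \<le> H\<close>, and the inequality reads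
\<open>tr (H^(a-1) S^2) \<le> tr (H^a S)\<close>. In the eigenbasis of \<open>H\<close>, let \<open>\<sigma>\<close> be the matrix of
\<open>S\<close>. The exchange inequality, applied to each pair of eigenvalues, replaces the left
side by the sum of the \<open>h j^a * (\<sigma> i j)^2 / h i\<close>. The sum over \<open>i\<close> is the diagonal
entry at \<open>j\<close> of \<open>S H^(-1) S\<close>, which is at most that of \<open>S\<close>, because \<open>S \<le> H\<close> gives
\<open>S H^(-1) S \<le> S\<close>. This last step is a Cauchy-Schwarz inequality for the form of \<open>S\<close>.
Eigenvalues 0 of \<open>H\<close> cause no trouble, as \<open>X\<close> vanishes on their eigenvectors.\<close>

lemma trace_powr_square_le:
  fixes X :: "real^'m::finite^'m"
  assumes H: "eigensystem H e h" "transpose H = H" "\<And>i. 0 \<le> h i"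
    and le: "\<And>x. (norm (X *v x))\<^sup>2 \<le> x \<bullet> (H *v x)" and a: "0 \<le> a"
  defines "S \<equiv> transpose X ** X"
  shows "(\<Sum>j\<in>UNIV. h j powr (a - 1) * (norm (S *v e j))\<^sup>2) \<le> (\<Sum>j\<in>UNIV. h j powr a * (e j \<bullet> (S *v e j)))"
proof -
  note on = eigensystemD(1)[OF H(1)]
  define \<sigma> where "\<sigma> i j = (X *v e i) \<bullet> (X *v e j)" for i j
  have Xe: "(norm (X *v e j))\<^sup>2 \<le> h j" for j
    using le[of "e j"] eigensystemD[OF H(1)] by (simp add: orthonormal_family_def)
  have S_inner: "x \<bullet> (S *v y) = (X *v x) \<bullet> (X *v y)" for x y
    by (simp add: S_def inner_transpose_matrix flip: matrix_vector_mul_assoc)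
  have \<sigma>_sym: "\<sigma> i j = \<sigma> j i" for i j by (simp add: \<sigma>_def inner_commute)
  have \<sigma>_0: "\<sigma> i j = 0" if "h i = 0" for i j using Xe[of i] that by (simp add: \<sigma>_def)
  have row: "(\<Sum>i\<in>UNIV. (\<sigma> i j)\<^sup>2 / h i) \<le> \<sigma> j j" for j
  proof -
    (* y is H^+ S (e j) for the pseudo-inverse H^+ of H, since division by a zero eigenvalue gives 0 *)
    define y where "y = (\<Sum>i\<in>UNIV. (\<sigma> i j / h i) *\<^sub>R e i)"
    define c where "c = (\<Sum>i\<in>UNIV. (\<sigma> i j)\<^sup>2 / h i)"
    have c0: "0 \<le> c" using H(3) by (simp add: c_def sum_nonneg)
    have "X *v y = (\<Sum>i\<in>UNIV. (\<sigma> i j / h i) *\<^sub>R (X *v e i))"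
      by (simp add: y_def matrix_vector_right_distrib linear_sum[OF matrix_vector_mul_linear] matrix_vector_mult_scaleR)
    then have 1: "(X *v y) \<bullet> (X *v e j) = c"
      by (simp add: inner_sum_left c_def power2_eq_square flip: \<sigma>_def)
    have coord: "e i \<bullet> y = \<sigma> i j / h i" for i
      using on by (simp add: y_def inner_sum_right orthonormal_family_def if_distrib[of "\<lambda>x. _ * x"] cong: if_cong)
    have "y \<bullet> (H *v y) = c"
      unfolding eigensystem_quadratic_form[OF H(1,2)] coord c_def
      by (rule sum.cong) (auto simp: power2_eq_square)
    then have "(X *v y) \<bullet> (X *v y) \<le> c" using le[of y] by (simp add: power2_norm_eq_inner)
    then have "c\<^sup>2 \<le> c * \<sigma> j j"
      using Cauchy_Schwarz_ineq[of "X *v y" "X *v e j"] 1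
        mult_right_mono[of "(X *v y) \<bullet> (X *v y)" c "\<sigma> j j"] by (simp add: \<sigma>_def)
    then show ?thesis using c0 by (cases "c = 0") (auto simp: power2_eq_square \<sigma>_def c_def)
  qed
  let ?L = "\<Sum>j\<in>UNIV. \<Sum>i\<in>UNIV. h j powr (a - 1) * (\<sigma> i j)\<^sup>2"
  let ?R = "\<Sum>j\<in>UNIV. \<Sum>i\<in>UNIV. h j powr a * ((\<sigma> i j)\<^sup>2 / h i)"
  (* the sum over i and j is symmetrized so that powr_exchange_le applies to each pair *)
  have "?L + ?L = ?L + (\<Sum>j\<in>UNIV. \<Sum>i\<in>UNIV. h i powr (a - 1) * (\<sigma> i j)\<^sup>2)"
    by (subst (4) sum.swap) (simp add: \<sigma>_sym)
  also have "\<dots> = (\<Sum>j\<in>UNIV. \<Sum>i\<in>UNIV. (h j powr (a - 1) + h i powr (a - 1)) * (\<sigma> i j)\<^sup>2)"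
    by (simp add: sum.distrib distrib_right)
  also have "\<dots> \<le> (\<Sum>j\<in>UNIV. \<Sum>i\<in>UNIV. (h j powr a / h i + h i powr a / h j) * (\<sigma> i j)\<^sup>2)"
  proof (intro sum_mono)
    fix i j
    show "(h j powr (a - 1) + h i powr (a - 1)) * (\<sigma> i j)\<^sup>2 \<le> (h j powr a / h i + h i powr a / h j) * (\<sigma> i j)\<^sup>2"
    proof (cases "h i = 0 \<or> h j = 0")
      case True
      then have "\<sigma> i j = 0" using \<sigma>_0 \<sigma>_sym by metis
      then show ?thesis by simp
    next
      case False
      then show ?thesis using H(3)[of i] H(3)[of j] a
        by (intro mult_right_mono powr_exchange_le) auto
    qed
  qed
  also have "\<dots> = ?R + (\<Sum>j\<in>UNIV. \<Sum>i\<in>UNIV. h i powr a * ((\<sigma> i j)\<^sup>2 / h j))"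
    by (simp add: sum.distrib distrib_right)
  also have "\<dots> = ?R + ?R"
    by (subst (3) sum.swap) (simp add: \<sigma>_sym)
  finally have "?L \<le> ?R" by simp
  also have "?R \<le> (\<Sum>j\<in>UNIV. h j powr a * \<sigma> j j)"
    unfolding sum_distrib_left[symmetric] by (intro sum_mono mult_left_mono row) simp
  finally show ?thesis
    by (simp add: parseval_norm[OF on] S_inner \<sigma>_def sum_distrib_left)
qed

text \<open>With \<open>S = X^T X\<close>, the hypothesis is \<open>S \<le> H\<close>, and the inequality reads
\<open>tr (H^(2r-1) S) \<le> tr (H^r S^r)\<close>. The function \<open>g \<theta> = tr (H^\<theta> S^(2r-\<theta>))\<close> is convex, as
a nonnegative combination of exponential functions of \<open>\<theta>\<close>, one for each pair of
positive eigenvalues of \<open>H\<close> and \<open>S\<close>. By \<open>trace_powr_square_le\<close> with \<open>a = 2r - 1\<close> it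
satisfies \<open>g (2r-2) \<le> g (2r-1)\<close>, and therefore \<open>g (2r-1) \<le> g r\<close> because \<open>2r-1 \<le> r\<close>.
The convexity is used in the form \<open>g r \<ge> g (2r-1) + (1-r) * (g (2r-1) - g (2r-2))\<close>,
which holds for each pair of eigenvectors of \<open>H\<close> and \<open>S\<close>.\<close>

lemma trace_powr_mult_le:
  fixes X :: "real^'m::finite^'m"
  assumes H: "eigensystem H e h" "transpose H = H" "\<And>i. 0 \<le> h i"
    and le: "\<And>x. (norm (X *v x))\<^sup>2 \<le> x \<bullet> (H *v x)" and r: "1 / 2 \<le> r" "r \<le> 1"
    and S: "eigensystem (transpose X ** X) u s"
    and P: "eigensystem P u (\<lambda>i. s i powr r)" "transpose P = P"
  shows "(\<Sum>j\<in>UNIV. h j powr (2 * r - 1) * (norm (X *v e j))\<^sup>2) \<le> (\<Sum>j\<in>UNIV. h j powr r * (e j \<bullet> (P *v e j)))"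
proof -
  define S where "S = transpose X ** X"
  note S' = S[folded S_def]
  have S_sym: "transpose S = S" by (simp add: S_def gram_symmetric)
  have s: "0 \<le> s i" for i using gram_eigenvalue[OF S] by simp
  have Xe: "(norm (X *v x))\<^sup>2 = x \<bullet> (S *v x)" for x
    by (simp add: S_def inner_transpose_matrix power2_norm_eq_inner flip: matrix_vector_mul_assoc)
  define w where "w i j = (u i \<bullet> e j)\<^sup>2" for i j
  (* with t = x * \<eta> this is x^r - x \<ge> (1 - r) * (x - x^2), a tangent line bound *)
  have scalar: "\<eta> powr (2 * r - 1) * t + (1 - r) * (\<eta> powr (2 * r - 1) * t - \<eta> powr (2 * r - 2) * t\<^sup>2)
      \<le> \<eta> powr r * t powr r" if "0 \<le> \<eta>" "0 \<le> t" for \<eta> t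
  proof (cases "\<eta> = 0 \<or> t = 0")
    case False
    with that have pos: "0 < \<eta>" "0 < t" by auto
    have "1 - (1 - r) * (t / \<eta> - 1) \<le> (t / \<eta>) powr (- (1 - r))"
      using pos r by (intro powr_tangent_neg) auto
    then have "\<eta> powr (2 * r - 1) * t * (1 - (1 - r) * (t / \<eta> - 1))
        \<le> \<eta> powr (2 * r - 1) * t * (t / \<eta>) powr (- (1 - r))"
      using pos by (intro mult_left_mono) auto
    also have "\<eta> powr (2 * r - 1) * t * (t / \<eta>) powr (- (1 - r)) = \<eta> powr r * t powr r"
      using pos by (simp add: powr_divide powr_diff powr_minus power2_eq_square field_simps flip: powr_add)
    also have "\<eta> powr (2 * r - 1) * t * (1 - (1 - r) * (t / \<eta> - 1))
      = \<eta> powr (2 * r - 1) * t + (1 - r) * (\<eta> powr (2 * r - 1) * t - \<eta> powr (2 * r - 2) * t\<^sup>2)"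
    proof -
      have "\<eta> powr (2 * r - 1) = \<eta> powr (2 * r - 2) * \<eta>"
        using pos by (simp add: powr_diff power2_eq_square)
      then show ?thesis using pos by (simp add: power2_eq_square field_simps)
    qed
    finally show ?thesis .
  qed auto
  have column: "h j powr (2 * r - 1) * (norm (X *v e j))\<^sup>2
      + (1 - r) * (h j powr (2 * r - 1) * (norm (X *v e j))\<^sup>2 - h j powr (2 * r - 2) * (norm (S *v e j))\<^sup>2)
      \<le> h j powr r * (e j \<bullet> (P *v e j))" for j
  proof -
    have 1: "(norm (X *v e j))\<^sup>2 = (\<Sum>i\<in>UNIV. s i * w i j)"
      by (simp add: Xe eigensystem_quadratic_form[OF S' S_sym] w_def)
    have 2: "(norm (S *v e j))\<^sup>2 = (\<Sum>i\<in>UNIV. (s i)\<^sup>2 * w i j)"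
      by (simp add: parseval_norm[OF eigensystemD(1)[OF S']] eigensystem_inner[OF S' S_sym]
          w_def power_mult_distrib)
    have 3: "e j \<bullet> (P *v e j) = (\<Sum>i\<in>UNIV. s i powr r * w i j)"
      by (simp add: eigensystem_quadratic_form[OF P] w_def)
    have "(\<Sum>i\<in>UNIV. (h j powr (2 * r - 1) * s i
          + (1 - r) * (h j powr (2 * r - 1) * s i - h j powr (2 * r - 2) * (s i)\<^sup>2)) * w i j)
        \<le> (\<Sum>i\<in>UNIV. (h j powr r * s i powr r) * w i j)"
      by (intro sum_mono mult_right_mono scalar H s) (simp add: w_def)
    also have "(\<Sum>i\<in>UNIV. (h j powr (2 * r - 1) * s i
          + (1 - r) * (h j powr (2 * r - 1) * s i - h j powr (2 * r - 2) * (s i)\<^sup>2)) * w i j)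
        = (\<Sum>i\<in>UNIV. (2 - r) * h j powr (2 * r - 1) * (s i * w i j)
          - (1 - r) * h j powr (2 * r - 2) * ((s i)\<^sup>2 * w i j))"
      by (rule sum.cong) (auto simp: algebra_simps)
    also have "\<dots> = (2 - r) * h j powr (2 * r - 1) * (norm (X *v e j))\<^sup>2
        - (1 - r) * h j powr (2 * r - 2) * (norm (S *v e j))\<^sup>2"
      by (simp only: 1 2 sum_distrib_left sum_subtractf)
    also have "(\<Sum>i\<in>UNIV. (h j powr r * s i powr r) * w i j) = h j powr r * (e j \<bullet> (P *v e j))"
      by (simp only: 3 sum_distrib_left mult.assoc)
    finally show ?thesis by (simp add: algebra_simps)
  qed
  define L where "L = (\<Sum>j\<in>UNIV. h j powr (2 * r - 1) * (norm (X *v e j))\<^sup>2)"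
  define Q where "Q = (\<Sum>j\<in>UNIV. h j powr (2 * r - 2) * (norm (S *v e j))\<^sup>2)"
  have "Q \<le> L"
    using trace_powr_square_le[OF H le, of "2 * r - 1"] r by (simp add: L_def Q_def Xe S_def)
  then have "L \<le> L + (1 - r) * (L - Q)" using r by simp
  also have "\<dots> = (\<Sum>j\<in>UNIV. h j powr (2 * r - 1) * (norm (X *v e j))\<^sup>2
      + (1 - r) * (h j powr (2 * r - 1) * (norm (X *v e j))\<^sup>2 - h j powr (2 * r - 2) * (norm (S *v e j))\<^sup>2))"
    by (simp add: L_def Q_def sum.distrib sum_subtractf flip: sum_distrib_left)
  also have "\<dots> \<le> (\<Sum>j\<in>UNIV. h j powr r * (e j \<bullet> (P *v e j)))" by (intro sum_mono column)
  finally show ?thesis by (simp add: L_def)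
qed

section \<open>Comparing the Gram matrix of two stacked matrices with their powers\<close>

text \<open>Characterizes the power \<open>P = |A|^p\<close> by the eigenbasis that it shares with
\<open>A^T A\<close>.\<close>

definition abs_power :: "real^'m^'m::finite \<Rightarrow> real \<Rightarrow> real^'m^'m \<Rightarrow> bool" where
  "abs_power A p P \<longleftrightarrow> transpose P = P \<and>
     (\<exists>u s. eigensystem (transpose A ** A) u s \<and> eigensystem P u (\<lambda>i. s i powr (p / 2)))"

lemma abs_powerE:
  assumes "abs_power A p P"
  obtains u s where "eigensystem (transpose A ** A) u s" "\<And>i. 0 \<le> s i"
    "eigensystem P u (\<lambda>i. s i powr (p / 2))" "transpose P = P"
proof -
  obtain u s where us: "eigensystem (transpose A ** A) u s" "eigensystem P u (\<lambda>i. s i powr (p / 2))"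
    "transpose P = P"
    using assms by (auto simp: abs_power_def)
  moreover have "0 \<le> s i" for i using gram_eigenvalue[OF us(1)] by simp
  ultimately show thesis using that by blast
qed

lemma abs_power_bcirc: "abs_power (bcirc A) p (bcirc (tpowr (tabs A) p))"
proof -
  obtain u s where "eigensystem (transpose (bcirc A) ** bcirc A) u s"
    using symmetric_matrix_eigensystem[OF gram_symmetric] .
  with bcirc_tabs_powr[OF this] show ?thesis by (auto simp: abs_power_def)
qed

lemma inner_gram: "x \<bullet> ((transpose A ** A) *v y) = (A *v x) \<bullet> (A *v y)"
  for A :: "real^'n::finite^'m::finite"
  by (simp add: inner_transpose_matrix flip: matrix_vector_mul_assoc)

lemma abs_power_nonneg:
  assumes "abs_power A p P"
  shows "0 \<le> x \<bullet> (P *v x)"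
proof -
  obtain u s where us: "eigensystem P u (\<lambda>i. s i powr (p / 2))" "transpose P = P"
    using abs_powerE[OF assms] by metis
  then show ?thesis by (simp add: eigensystem_quadratic_form sum_nonneg)
qed

text \<open>Multiplication by the block column of \<open>A\<close> over \<open>B\<close>. As a map into a product
space its inner products split into those of the blocks.\<close>

definition stack :: "real^'m^'m \<Rightarrow> real^'m^'m \<Rightarrow> real^'m \<Rightarrow> (real^'m) \<times> (real^'m::finite)" where
  "stack A B x = (A *v x, B *v x)"

text \<open>The Gram matrix of the block column, as \<open>inner_gram2\<close> shows.\<close>

definition gram2 :: "real^'m^'m \<Rightarrow> real^'m^'m \<Rightarrow> real^'m^'m::finite" where
  "gram2 A B = transpose A ** A + transpose B ** B"

lemma inner_gram2: "x \<bullet> (gram2 A B *v y) = stack A B x \<bullet> stack A B y"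
  by (simp add: gram2_def stack_def matrix_vector_mult_add_rdistrib inner_add_right inner_gram)

lemma norm_stack: "(norm (stack A B x))\<^sup>2 = (norm (A *v x))\<^sup>2 + (norm (B *v x))\<^sup>2"
  by (simp add: stack_def norm_Pair)

lemma stack_inner_stack:
  "stack C D y \<bullet> stack A B x = y \<bullet> ((transpose C ** A + transpose D ** B) *v x)"
  by (simp add: stack_def matrix_vector_mult_add_rdistrib inner_add_right inner_transpose_matrix
      flip: matrix_vector_mul_assoc)

lemma transpose_add: "transpose (X + Y) = transpose X + transpose (Y :: real^'n^'m)"
  by (simp add: transpose_def vec_eq_iff)

lemma gram2_symmetric: "transpose (gram2 A B) = gram2 A B"
  by (simp add: gram2_def transpose_add gram_symmetric)

text \<open>Provides the orthogonal families to which the Hoelder inequality is applied.\<close>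

lemma gram2_eigenvectors:
  assumes "eigensystem (gram2 A B) e h"
  shows "stack A B (e i) \<bullet> stack A B (e j) = (if i = j then h i else 0)"
  using eigensystemD[OF assms] by (simp add: inner_gram2[symmetric] orthonormal_family_def)

lemma gram2_eigenvalue_nonneg:
  assumes "eigensystem (gram2 A B) e h"
  shows "0 \<le> h i"
  using gram2_eigenvectors[OF assms, of i i] inner_ge_zero[of "stack A B (e i)"] by simp

text \<open>With \<open>H = S + T\<close> for \<open>S = A^T A\<close> and \<open>T = B^T B\<close>, and \<open>r = p / 2\<close>, the trace of
\<open>H^(2r) = H^(2r-1) (S + T)\<close> is at most that of \<open>H^r (S^r + T^r)\<close> by the trace
inequality for \<open>S \<le> H\<close> and \<open>T \<le> H\<close>. By Cauchy-Schwarz this is at most the product of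
the Frobenius norms of \<open>H^r\<close> and \<open>S^r + T^r\<close>, and the first factor is the square root
of the left side.\<close>

lemma trace_gram2_powr_le:
  assumes P: "abs_power A p P" and Q: "abs_power B p Q" and p: "1 \<le> p" "p \<le> 2"
    and H: "eigensystem (gram2 A B) e h"
  shows "(\<Sum>j\<in>UNIV. h j powr p) \<le> (norm (P + Q))\<^sup>2"
proof -
  note h = gram2_eigenvalue_nonneg[OF H] and sym = gram2_symmetric[of A B]
  obtain u s where us: "eigensystem (transpose A ** A) u s"
    "eigensystem P u (\<lambda>i. s i powr (p / 2))" "transpose P = P" using abs_powerE[OF P] by metis
  obtain v t where vt: "eigensystem (transpose B ** B) v t"
    "eigensystem Q v (\<lambda>i. t i powr (p / 2))" "transpose Q = Q" using abs_powerE[OF Q] by metis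
  have le: "(norm (A *v x))\<^sup>2 \<le> x \<bullet> (gram2 A B *v x)" "(norm (B *v x))\<^sup>2 \<le> x \<bullet> (gram2 A B *v x)" for x
    by (simp_all add: inner_gram2 norm_stack flip: power2_norm_eq_inner)
  define m where "m j = e j \<bullet> ((P + Q) *v e j)" for j
  define T where "T = (\<Sum>j\<in>UNIV. h j powr p)"
  have r: "1 / 2 \<le> p / 2" "p / 2 \<le> 1" "2 * (p / 2) - 1 = p - 1" using p by auto
  have T0: "0 \<le> T" by (simp add: T_def sum_nonneg)
  have hj: "h j = (norm (A *v e j))\<^sup>2 + (norm (B *v e j))\<^sup>2" for j
    using gram2_eigenvectors[OF H, of j j] by (simp add: norm_stack flip: power2_norm_eq_inner)
  have "h j powr p = h j powr (p - 1) * (norm (A *v e j))\<^sup>2 + h j powr (p - 1) * (norm (B *v e j))\<^sup>2" for j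
  proof -
    have "h j powr p = h j powr (p - 1) * h j"
      using h[of j] by (cases "h j = 0") (auto simp: powr_diff)
    then show ?thesis by (subst (asm) (3) hj) (simp add: distrib_left)
  qed
  then have "T = (\<Sum>j\<in>UNIV. h j powr (p - 1) * (norm (A *v e j))\<^sup>2)
      + (\<Sum>j\<in>UNIV. h j powr (p - 1) * (norm (B *v e j))\<^sup>2)"
    by (simp add: T_def sum.distrib)
  also have "\<dots> \<le> (\<Sum>j\<in>UNIV. h j powr (p / 2) * (e j \<bullet> (P *v e j)))
      + (\<Sum>j\<in>UNIV. h j powr (p / 2) * (e j \<bullet> (Q *v e j)))"
    using trace_powr_mult_le[OF H sym h le(1) r(1,2) us] trace_powr_mult_le[OF H sym h le(2) r(1,2) vt]
    unfolding r(3) by (rule add_mono)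
  also have "\<dots> = (\<Sum>j\<in>UNIV. h j powr (p / 2) * m j)"
    by (simp add: m_def matrix_vector_mult_add_rdistrib inner_add_right distrib_left sum.distrib)
  finally have "T \<le> (\<Sum>j\<in>UNIV. h j powr (p / 2) * m j)" .
  then have "T\<^sup>2 \<le> (\<Sum>j\<in>UNIV. h j powr (p / 2) * m j)\<^sup>2" using T0 by (rule power_mono)
  also have "\<dots> \<le> (\<Sum>j\<in>UNIV. (h j powr (p / 2))\<^sup>2) * (\<Sum>j\<in>UNIV. (m j)\<^sup>2)"
    by (rule Cauchy_Schwarz_ineq_sum)
  also have "(\<Sum>j\<in>UNIV. (h j powr (p / 2))\<^sup>2) = T"
    by (simp add: T_def power2_eq_square flip: powr_add)
  also have "T * (\<Sum>j\<in>UNIV. (m j)\<^sup>2) \<le> T * (norm (P + Q))\<^sup>2"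
    unfolding m_def by (intro mult_left_mono sum_diagonal_squares_le eigensystemD(1)[OF H] T0)
  finally have "T * T \<le> T * (norm (P + Q))\<^sup>2" by (simp add: power2_eq_square)
  then show ?thesis using T0 by (cases "T = 0") (auto simp: T_def)
qed

text \<open>Two uses of convexity: midpoint convexity separates \<open>A\<close> from \<open>B\<close>, and Jensen's
inequality moves the power into the quadratic forms.\<close>

lemma norm_stack_powr_le:
  fixes A B P Q :: "real^'m::finite^'m"
  assumes P: "abs_power A q P" and Q: "abs_power B q Q" and q: "2 \<le> q" and x: "norm x = 1"
  shows "((norm (stack A B x))\<^sup>2) powr (q / 2) \<le> 2 powr (q / 2 - 1) * (x \<bullet> ((P + Q) *v x))"
proof -
  have one: "((norm (X *v x))\<^sup>2) powr (q / 2) \<le> x \<bullet> (R *v x)" if R: "abs_power X q R" for X R :: "real^'m^'m"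
  proof -
    obtain u s where us: "eigensystem (transpose X ** X) u s" "\<And>i. 0 \<le> s i"
      "eigensystem R u (\<lambda>i. s i powr (q / 2))" "transpose R = R" using abs_powerE[OF R] by metis
    have "(norm (X *v x))\<^sup>2 = x \<bullet> ((transpose X ** X) *v x)"
      by (simp add: inner_gram power2_norm_eq_inner)
    then show ?thesis
      using quadratic_form_powr_le[OF us(1) gram_symmetric us(2,3,4) _ x] q by simp
  qed
  have "((norm (stack A B x))\<^sup>2) powr (q / 2)
      \<le> 2 powr (q / 2 - 1) * (((norm (A *v x))\<^sup>2) powr (q / 2) + ((norm (B *v x))\<^sup>2) powr (q / 2))"
    unfolding norm_stack using q by (intro powr_add_le) auto
  also have "\<dots> \<le> 2 powr (q / 2 - 1) * (x \<bullet> (P *v x) + x \<bullet> (Q *v x))"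
    by (intro mult_left_mono add_mono one P Q) simp
  finally show ?thesis by (simp add: matrix_vector_mult_add_rdistrib inner_add_right)
qed

lemma trace_gram2_powr_le_convex:
  assumes P: "abs_power A q P" and Q: "abs_power B q Q" and q: "2 \<le> q"
    and H: "eigensystem (gram2 A B) e h"
  shows "(\<Sum>j\<in>UNIV. h j powr q) \<le> 2 powr (q - 2) * (norm (P + Q))\<^sup>2"
proof -
  have "h j powr q \<le> 2 powr (q - 2) * (e j \<bullet> ((P + Q) *v e j))\<^sup>2" for j
  proof -
    have "norm (e j) = 1"
      using eigensystemD(1)[OF H] by (simp add: orthonormal_family_def norm_eq_1)
    moreover have "(norm (stack A B (e j)))\<^sup>2 = h j"
      by (simp add: power2_norm_eq_inner gram2_eigenvectors[OF H])
    ultimately have "h j powr (q / 2) \<le> 2 powr (q / 2 - 1) * (e j \<bullet> ((P + Q) *v e j))"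
      using norm_stack_powr_le[OF P Q q] by metis
    then have "(h j powr (q / 2))\<^sup>2 \<le> (2 powr (q / 2 - 1) * (e j \<bullet> ((P + Q) *v e j)))\<^sup>2"
      by (rule power_mono) simp
    then show ?thesis by (simp add: power_mult_distrib) (simp add: power2_eq_square flip: powr_add)
  qed
  then have "(\<Sum>j\<in>UNIV. h j powr q) \<le> 2 powr (q - 2) * (\<Sum>j\<in>UNIV. (e j \<bullet> ((P + Q) *v e j))\<^sup>2)"
    unfolding sum_distrib_left by (rule sum_mono)
  also have "\<dots> \<le> 2 powr (q - 2) * (norm (P + Q))\<^sup>2"
    by (intro mult_left_mono sum_diagonal_squares_le eigensystemD(1)[OF H]) simp
  finally show ?thesis .
qed

lemma quadratic_form_le_onorm:
  fixes M :: "real^'m::finite^'m"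
  shows "x \<bullet> (M *v x) \<le> onorm ((*v) M) * (norm x)\<^sup>2"
proof -
  have "x \<bullet> (M *v x) \<le> norm x * norm (M *v x)" by (rule norm_cauchy_schwarz)
  also have "\<dots> \<le> norm x * (onorm ((*v) M) * norm x)"
    by (intro mult_left_mono onorm matrix_vector_mul_bounded_linear) simp
  finally show ?thesis by (simp add: power2_eq_square mult_ac)
qed

text \<open>If \<open>L\<close> is the norm of \<open>P + Q\<close>, then \<open>0 \<le> P \<le> L\<close>, so that
\<open>A^T A = P^(2/p) \<le> L^(2/p-1) P\<close>, and likewise for \<open>B\<close>. Adding the two gives
\<open>A^T A + B^T B \<le> L^(2/p-1) (P + Q) \<le> L^(2/p)\<close>.\<close>

lemma norm_stack_le_concave:
  fixes A B P Q :: "real^'m::finite^'m"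
  assumes P: "abs_power A p P" and Q: "abs_power B p Q" and p: "1 \<le> p" "p \<le> 2"
  shows "(norm (stack A B x))\<^sup>2 \<le> (onorm ((*v) (P + Q)) powr (1 / p))\<^sup>2 * (norm x)\<^sup>2"
proof -
  define L where "L = onorm ((*v) (P + Q))"
  have L0: "0 \<le> L" unfolding L_def by (intro onorm_pos_le matrix_vector_mul_bounded_linear)
  have sum_le: "x \<bullet> (P *v x) + x \<bullet> (Q *v x) \<le> L * (norm x)\<^sup>2" for x
    using quadratic_form_le_onorm[of x "P + Q"]
    by (simp add: L_def matrix_vector_mult_add_rdistrib inner_add_right)
  have one: "(norm (X *v x))\<^sup>2 \<le> L powr (2 / p - 1) * (x \<bullet> (R *v x))"
    if R: "abs_power X p R" and le: "\<And>x. x \<bullet> (R *v x) \<le> L * (norm x)\<^sup>2" for X R :: "real^'m^'m" and x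
  proof -
    obtain u s where us: "eigensystem (transpose X ** X) u s" "\<And>i. 0 \<le> s i"
      "eigensystem R u (\<lambda>i. s i powr (p / 2))" "transpose R = R" using abs_powerE[OF R] by metis
    (* each eigenvalue y of R lies in [0, L], and 2 / p - 1 \<ge> 0, so y^(2/p) \<le> L^(2/p-1) * y *)
    have s: "s i \<le> L powr (2 / p - 1) * s i powr (p / 2)" for i
    proof -
      have "s i powr (p / 2) \<le> L"
        using le[of "u i"] eigensystemD[OF us(3)]
        by (simp add: orthonormal_family_def power2_norm_eq_inner)
      then have "(s i powr (p / 2)) powr (2 / p - 1) \<le> L powr (2 / p - 1)"
        using p by (intro powr_mono2) (auto simp: field_simps)
      then have "(s i powr (p / 2)) powr (2 / p - 1) * s i powr (p / 2) \<le> L powr (2 / p - 1) * s i powr (p / 2)"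
        by (intro mult_right_mono) auto
      moreover have "(s i powr (p / 2)) powr (2 / p - 1) * s i powr (p / 2) = s i"
        using p us(2)[of i] by (simp add: powr_powr field_simps flip: powr_add)
      ultimately show ?thesis by simp
    qed
    have "(norm (X *v x))\<^sup>2 = x \<bullet> ((transpose X ** X) *v x)"
      by (simp add: inner_gram power2_norm_eq_inner)
    also have "\<dots> = (\<Sum>i\<in>UNIV. s i * (u i \<bullet> x)\<^sup>2)"
      by (rule eigensystem_quadratic_form[OF us(1) gram_symmetric])
    also have "\<dots> \<le> (\<Sum>i\<in>UNIV. L powr (2 / p - 1) * s i powr (p / 2) * (u i \<bullet> x)\<^sup>2)"
      by (intro sum_mono mult_right_mono s) simp
    also have "\<dots> = L powr (2 / p - 1) * (x \<bullet> (R *v x))"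
      by (simp add: eigensystem_quadratic_form[OF us(3,4)] sum_distrib_left mult.assoc)
    finally show ?thesis .
  qed
  have "x \<bullet> (P *v x) \<le> L * (norm x)\<^sup>2" "x \<bullet> (Q *v x) \<le> L * (norm x)\<^sup>2" for x
    using sum_le[of x] abs_power_nonneg[OF P, of x] abs_power_nonneg[OF Q, of x] by linarith+
  then have "(norm (stack A B x))\<^sup>2 \<le> L powr (2 / p - 1) * (x \<bullet> (P *v x)) + L powr (2 / p - 1) * (x \<bullet> (Q *v x))"
    unfolding norm_stack by (intro add_mono one P Q)
  also have "\<dots> = L powr (2 / p - 1) * (x \<bullet> (P *v x) + x \<bullet> (Q *v x))" by (simp add: distrib_left)
  also have "\<dots> \<le> L powr (2 / p - 1) * (L * (norm x)\<^sup>2)"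
    by (intro mult_left_mono sum_le) simp
  also have "\<dots> = (L powr (1 / p))\<^sup>2 * (norm x)\<^sup>2"
  proof -
    have "(L powr (1 / p))\<^sup>2 = L powr (2 / p)" by (simp add: power2_eq_square flip: powr_add)
    then show ?thesis using L0 by (cases "L = 0") (auto simp: powr_diff)
  qed
  finally show ?thesis by (simp add: L_def)
qed

lemma norm_stack_le_convex:
  fixes A B P Q :: "real^'m::finite^'m"
  assumes P: "abs_power A q P" and Q: "abs_power B q Q" and q: "2 \<le> q"
  shows "(norm (stack A B x))\<^sup>2
    \<le> (2 powr (1 / 2 - 1 / q) * onorm ((*v) (P + Q)) powr (1 / q))\<^sup>2 * (norm x)\<^sup>2"
proof (cases "x = 0")
  case False
  define L where "L = onorm ((*v) (P + Q))"
  have L0: "0 \<le> L" unfolding L_def by (intro onorm_pos_le matrix_vector_mul_bounded_linear)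
  define z where "z = x /\<^sub>R norm x"
  have z: "norm z = 1" using False by (simp add: z_def)
  define t where "t = (norm (stack A B z))\<^sup>2"
  have "z \<bullet> ((P + Q) *v z) \<le> L"
    using quadratic_form_le_onorm[of z "P + Q"] z by (simp add: L_def)
  then have "t powr (q / 2) \<le> 2 powr (q / 2 - 1) * L"
    unfolding t_def by (intro order_trans[OF norm_stack_powr_le[OF P Q q z]] mult_left_mono) simp_all
  then have "(t powr (q / 2)) powr (2 / q) \<le> (2 powr (q / 2 - 1) * L) powr (2 / q)"
    using q by (intro powr_mono2) auto
  also have "(t powr (q / 2)) powr (2 / q) = t" using q by (simp add: powr_powr t_def)
  also have "(2 powr (q / 2 - 1) * L) powr (2 / q) = (2 powr (1 / 2 - 1 / q) * L powr (1 / q))\<^sup>2"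
  proof -
    have e: "(q / 2 - 1) * (2 / q) = (1 / 2 - 1 / q) + (1 / 2 - 1 / q)" "2 / q = 1 / q + 1 / q"
      using q by (simp_all add: field_simps)
    show ?thesis
      unfolding powr_mult powr_powr e(1) unfolding e(2)
      by (simp only: powr_add power2_eq_square mult_ac)
  qed
  finally have t: "t \<le> (2 powr (1 / 2 - 1 / q) * L powr (1 / q))\<^sup>2" .
  have "x = norm x *\<^sub>R z" using False by (simp add: z_def)
  then have "stack A B x = norm x *\<^sub>R stack A B z"
    by (metis (no_types) matrix_vector_mult_scaleR scaleR_Pair stack_def)
  then have "(norm (stack A B x))\<^sup>2 = t * (norm x)\<^sup>2" by (simp add: t_def power_mult_distrib)
  also have "\<dots> \<le> (2 powr (1 / 2 - 1 / q) * L powr (1 / q))\<^sup>2 * (norm x)\<^sup>2"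
    by (intro mult_right_mono t) simp
  finally show ?thesis by (simp add: L_def)
qed (simp add: stack_def)

section \<open>Norms of the product of two block columns\<close>

lemma onorm_cross_gram_le:
  fixes A B C D :: "real^'m::finite^'m"
  assumes a: "\<And>x. (norm (stack A B x))\<^sup>2 \<le> a\<^sup>2 * (norm x)\<^sup>2" "0 \<le> a"
    and b: "\<And>x. (norm (stack C D x))\<^sup>2 \<le> b\<^sup>2 * (norm x)\<^sup>2" "0 \<le> b"
  shows "onorm ((*v) (transpose C ** A + transpose D ** B)) \<le> a * b"
proof (rule onorm_le)
  fix x
  let ?y = "(transpose C ** A + transpose D ** B) *v x"
  have "norm (stack A B x) \<le> a * norm x"
    by (rule power2_le_imp_le) (simp_all add: power_mult_distrib a)
  moreover have "norm (stack C D ?y) \<le> b * norm ?y"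
    by (rule power2_le_imp_le) (simp_all add: power_mult_distrib b)
  ultimately have "norm (stack C D ?y) * norm (stack A B x) \<le> (b * norm ?y) * (a * norm x)"
    using b(2) by (intro mult_mono) auto
  then have "stack C D ?y \<bullet> stack A B x \<le> (b * norm ?y) * (a * norm x)"
    by (rule order_trans[OF norm_cauchy_schwarz])
  also have "stack C D ?y \<bullet> stack A B x = norm ?y * norm ?y"
    by (simp only: stack_inner_stack power2_norm_eq_inner[symmetric]) (simp only: power2_eq_square)
  finally have "norm ?y * norm ?y \<le> norm ?y * (a * b * norm x)" by (simp only: mult_ac)
  then show "norm ?y \<le> a * b * norm x"
    using a(2) b(2) by (cases "?y = 0") auto
qed

lemma norm_cross_gram:
  fixes A B C D :: "real^'m::finite^'m" and e g :: "'m \<Rightarrow> real^'m"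
  assumes "orthonormal_family e" "orthonormal_family g"
  shows "(norm (transpose C ** A + transpose D ** B))\<^sup>2
    = (\<Sum>j\<in>UNIV. \<Sum>i\<in>UNIV. (stack C D (g i) \<bullet> stack A B (e j))\<^sup>2)"
  by (simp add: norm_matrix_orthonormal[OF assms(1)] parseval_norm[OF assms(2)] stack_inner_stack)

text \<open>Evaluates the Frobenius norm of \<open>Y^T X\<close> in the eigenbases of \<open>X^T X\<close> and
\<open>Y^T Y\<close>, where \<open>X\<close> and \<open>Y\<close> are the block columns.\<close>

lemma norm_cross_gram_holder:
  assumes pq: "1 < p" "1 < q" "1 / p + 1 / q = 1"
    and H: "eigensystem (gram2 A B) e h" and G: "eigensystem (gram2 C D) g k"
  shows "(norm (transpose C ** A + transpose D ** B))\<^sup>2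
    \<le> (\<Sum>j\<in>UNIV. h j powr p) powr (1 / p) * (\<Sum>i\<in>UNIV. k i powr q) powr (1 / q)"
  using orthogonal_families_holder[OF pq, of "\<lambda>j. stack A B (e j)" "\<lambda>i. stack C D (g i)"]
  by (simp add: norm_cross_gram[OF H[THEN eigensystemD(1)] G[THEN eigensystemD(1)]]
      gram2_eigenvectors[OF H] gram2_eigenvectors[OF G])

text \<open>The counterpart for the exponents \<open>1\<close> and \<open>\<infinity>\<close>.\<close>

lemma norm_cross_gram_bound:
  assumes b: "\<And>x. (norm (stack C D x))\<^sup>2 \<le> b * (norm x)\<^sup>2"
    and H: "eigensystem (gram2 A B) e h"
  shows "(norm (transpose C ** A + transpose D ** B))\<^sup>2 \<le> b * (\<Sum>j\<in>UNIV. h j)"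
proof -
  obtain g k where G: "eigensystem (gram2 C D) g k"
    using symmetric_matrix_eigensystem[OF gram2_symmetric] .
  have "stack C D (g i) \<bullet> stack C D (g i) \<le> b" for i
    using b[of "g i"] eigensystemD(1)[OF G] by (simp add: orthonormal_family_def power2_norm_eq_inner)
  then show ?thesis
    using orthogonal_families_bound[of "\<lambda>i. stack C D (g i)" b "\<lambda>j. stack A B (e j)"]
    by (simp add: norm_cross_gram[OF H[THEN eigensystemD(1)] G[THEN eigensystemD(1)]]
      gram2_eigenvectors[OF H] gram2_eigenvectors[OF G])
qed

section \<open>Passing from matrices to tensors\<close>

lemma bcirc_add: "bcirc (A + B) = bcirc A + bcirc B"
  by (simp add: bcirc_def vec_eq_iff)

text \<open>Each frontal slice occurs once in every block column of the block circulant
matrix.\<close>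

lemma norm_bcirc:
  fixes A :: "('a::finite, 'b::finite, 'k::{finite,linorder}) tensor"
  shows "(norm (bcirc A))\<^sup>2 = real CARD('k) * (norm A)\<^sup>2"
proof -
  define f where "f k = (\<Sum>i\<in>UNIV. \<Sum>j\<in>UNIV. (A $ k $ i $ j)\<^sup>2)" for k
  have A: "(norm A)\<^sup>2 = (\<Sum>k\<in>UNIV. f k)"
    by (simp add: norm_tensor f_def sum_nonneg)
  have "(norm (bcirc A))\<^sup>2 = (\<Sum>k\<in>UNIV. \<Sum>i\<in>UNIV. \<Sum>m\<in>UNIV. \<Sum>j\<in>UNIV. (A $ slice_diff k m $ i $ j)\<^sup>2)"
    unfolding power2_norm_eq_inner
    by (simp add: inner_vec_def bcirc_def power2_eq_square sum.cartesian_product' flip: UNIV_Times_UNIV)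
  also have "\<dots> = (\<Sum>k\<in>UNIV. \<Sum>m\<in>UNIV. f (slice_diff k m))"
    unfolding f_def by (subst sum.swap) simp
  also have "\<dots> = (\<Sum>m\<in>UNIV. \<Sum>k\<in>UNIV. f (slice_diff k m))" by (rule sum.swap)
  also have "\<dots> = (\<Sum>m\<in>(UNIV :: 'k set). \<Sum>k\<in>UNIV. f k)"
    by (simp add: sum.reindex_bij_betw[OF bij_slice_diff])
  finally show ?thesis by (simp add: A)
qed

lemma spectral_norm_nonneg: "0 \<le> spectral_norm A"
  unfolding spectral_norm_def by (intro onorm_pos_le matrix_vector_mul_bounded_linear)

lemma power_sum_norm_nonneg:
  "0 \<le> power_sum_norm N p A B"
  by (simp add: power_sum_norm_def le_max_iff_disj spectral_norm_nonneg)

lemma power_sum_norm_ereal [simp]: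
  "power_sum_norm N (ereal p) A B = N (tpowr (tabs A) p + tpowr (tabs B) p) powr (1 / p)"
  by (simp add: power_sum_norm_def)

text \<open>Treats finite and infinite \<open>q\<close> alike: for \<open>q = \<infinity>\<close> the constant is \<open>2^(1/2)\<close>, as
two squares bounded by that of the larger spectral norm are added.\<close>

lemma norm_stack_bcirc_le:
  assumes q: "2 \<le> q"
  shows "(norm (stack (bcirc C) (bcirc D) x))\<^sup>2
    \<le> (2 powr (1 / 2 - real_of_ereal (1 / q)) * power_sum_norm spectral_norm q C D)\<^sup>2 * (norm x)\<^sup>2"
proof (cases q)
  case (real r)
  with q have r: "2 \<le> r" by simp
  then have "real_of_ereal (1 / q) = 1 / r" using real by (simp add: one_ereal_def)
  then show ?thesis
    using norm_stack_le_convex[OF abs_power_bcirc[of C r] abs_power_bcirc[of D r] r] real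
    by (simp add: spectral_norm_def bcirc_add)
next
  case PInf
  define b where "b = max (spectral_norm C) (spectral_norm D)"
  have one: "(norm (bcirc X *v x))\<^sup>2 \<le> b\<^sup>2 * (norm x)\<^sup>2" if "spectral_norm X \<le> b" for X
  proof -
    have "norm (bcirc X *v x) \<le> spectral_norm X * norm x"
      unfolding spectral_norm_def by (intro onorm matrix_vector_mul_bounded_linear)
    also have "\<dots> \<le> b * norm x" by (intro mult_right_mono that) simp
    finally have "(norm (bcirc X *v x))\<^sup>2 \<le> (b * norm x)\<^sup>2" by (rule power_mono) simp
    then show ?thesis by (simp add: power_mult_distrib)
  qed
  have "(norm (stack (bcirc C) (bcirc D) x))\<^sup>2 \<le> b\<^sup>2 * (norm x)\<^sup>2 + b\<^sup>2 * (norm x)\<^sup>2"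
    unfolding norm_stack by (intro add_mono one) (auto simp: b_def)
  moreover have "(2 powr (1 / 2))\<^sup>2 = (2 :: real)" by (simp add: powr_half_sqrt)
  ultimately show ?thesis using PInf
    by (simp add: power_sum_norm_def b_def power_mult_distrib mult_ac)
next
  case MInf
  then show ?thesis using q by simp
qed

lemma bcirc_cross:
  "bcirc (ttranspose C \<star> A + ttranspose D \<star> B)
    = transpose (bcirc C) ** bcirc A + transpose (bcirc D) ** bcirc B"
  by (simp add: bcirc_add bcirc_tprod bcirc_ttranspose)

lemma spectral_norm_cross_le:
  assumes p: "1 \<le> p" "p \<le> 2" and q: "2 \<le> q"
  shows "spectral_norm (ttranspose C \<star> A + ttranspose D \<star> B)
    \<le> 2 powr (1 / 2 - real_of_ereal (1 / q))
        * (power_sum_norm spectral_norm (ereal p) A B * power_sum_norm spectral_norm q C D)"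
proof -
  have a: "(norm (stack (bcirc A) (bcirc B) x))\<^sup>2
      \<le> (power_sum_norm spectral_norm (ereal p) A B)\<^sup>2 * (norm x)\<^sup>2" for x
    using norm_stack_le_concave[OF abs_power_bcirc[of A p] abs_power_bcirc[of B p] p]
    by (simp add: spectral_norm_def bcirc_add)
  show ?thesis
    using onorm_cross_gram_le[OF a power_sum_norm_nonneg norm_stack_bcirc_le[OF q]]
    by (simp add: spectral_norm_def[of "_ + _"] bcirc_cross power_sum_norm_nonneg mult_ac)
qed

text \<open>Combines Hoelder's inequality with the two comparisons of the Gram matrices. The
constant arises as the \<open>q\<close>-th root of \<open>2^(q-2)\<close>, which is the square of \<open>2^(1/p-1/2)\<close>.
The three norms of block circulant matrices contribute the factors \<open>n\<close> on the left and
\<open>n^(1/p) n^(1/q) = n\<close> on the right, where \<open>n\<close> is the number of slices.\<close>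

lemma frobenius_norm_cross_le:
  fixes A B C D :: "('n::finite, 'n, 'k::{finite,linorder}) tensor"
  assumes p: "1 \<le> p" "p \<le> 2" and q: "2 \<le> q" and pq: "1 / p + real_of_ereal (1 / q) = 1"
  shows "norm (ttranspose C \<star> A + ttranspose D \<star> B)
    \<le> 2 powr (1 / p - 1 / 2) * (power_sum_norm norm (ereal p) A B * power_sum_norm norm q C D)"
proof -
  define n where "n = real CARD('k)"
  have n: "0 < n" by (simp add: n_def)
  let ?K = "ttranspose C \<star> A + ttranspose D \<star> B"
  let ?P = "tpowr (tabs A) p + tpowr (tabs B) p"
  obtain e h where H: "eigensystem (gram2 (bcirc A) (bcirc B)) e h"
    using symmetric_matrix_eigensystem[OF gram2_symmetric] .
  have P: "(\<Sum>j\<in>UNIV. h j powr p) \<le> n * (norm ?P)\<^sup>2"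
    using trace_gram2_powr_le[OF abs_power_bcirc abs_power_bcirc p H]
    by (simp add: n_def norm_bcirc flip: bcirc_add)
  have nK: "n * (norm ?K)\<^sup>2 = (norm (transpose (bcirc C) ** bcirc A + transpose (bcirc D) ** bcirc B))\<^sup>2"
    by (simp only: n_def norm_bcirc[symmetric] bcirc_cross)
  have sq: "(x\<^sup>2) powr a = (x powr a)\<^sup>2" for x a :: real by (simp add: power2_eq_square powr_mult)
  have "(norm ?K)\<^sup>2 \<le> (2 powr (1 / p - 1 / 2) * (power_sum_norm norm (ereal p) A B * power_sum_norm norm q C D))\<^sup>2"
  proof (cases q)
    case (real r)
    with q pq have r: "2 \<le> r" "1 / p + 1 / r = 1" by (auto simp: one_ereal_def)
    then have p1: "1 < p" using p by (cases "p = 1") auto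
    let ?Q = "tpowr (tabs C) r + tpowr (tabs D) r"
    obtain g k where G: "eigensystem (gram2 (bcirc C) (bcirc D)) g k"
      using symmetric_matrix_eigensystem[OF gram2_symmetric] .
    have Q: "(\<Sum>j\<in>UNIV. k j powr r) \<le> 2 powr (r - 2) * (n * (norm ?Q)\<^sup>2)"
      using trace_gram2_powr_le_convex[OF abs_power_bcirc abs_power_bcirc r(1) G]
      by (simp add: n_def norm_bcirc flip: bcirc_add)
    have "n * (norm ?K)\<^sup>2 \<le> (\<Sum>j\<in>UNIV. h j powr p) powr (1 / p) * (\<Sum>j\<in>UNIV. k j powr r) powr (1 / r)"
      unfolding nK using norm_cross_gram_holder[OF p1 _ r(2) H G] r by simp
    also have "\<dots> \<le> (n * (norm ?P)\<^sup>2) powr (1 / p) * (2 powr (r - 2) * (n * (norm ?Q)\<^sup>2)) powr (1 / r)"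
      using P Q p1 r by (intro mult_mono powr_mono2) (auto simp: sum_nonneg)
    also have "\<dots> = n powr (1 / p + 1 / r) * 2 powr ((r - 2) / r)
        * (norm ?P powr (1 / p) * norm ?Q powr (1 / r))\<^sup>2"
      by (simp add: powr_mult powr_powr powr_add sq power_mult_distrib mult_ac)
    also have "(r - 2) / r = (1 / p - 1 / 2) + (1 / p - 1 / 2)"
    proof -
      have "(r - 2) / r = 1 - 2 * (1 / r)" using r(1) by (simp add: diff_divide_distrib)
      then show ?thesis using r(2) by linarith
    qed
    finally have "n * (norm ?K)\<^sup>2 \<le> n * (2 powr (1 / p - 1 / 2) * (norm ?P powr (1 / p) * norm ?Q powr (1 / r)))\<^sup>2"
      using n r(2) by (simp only: powr_add[of 2]) (simp add: power2_eq_square mult_ac)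
    then show ?thesis using n real by simp
  next
    case PInf
    with pq have p1: "p = 1" by simp
    define b where "b = 2 powr (1 / 2) * power_sum_norm norm q C D"
    have "(norm (stack (bcirc C) (bcirc D) x))\<^sup>2 \<le> b\<^sup>2 * (norm x)\<^sup>2" for x
      using norm_stack_bcirc_le[OF q, of C D x] PInf by (simp add: b_def power_sum_norm_def)
    from norm_cross_gram_bound[OF this H] have "n * (norm ?K)\<^sup>2 \<le> b\<^sup>2 * (\<Sum>j\<in>UNIV. h j)"
      by (simp add: nK)
    also have "\<dots> \<le> b\<^sup>2 * (n * (norm ?P)\<^sup>2)"
      using P gram2_eigenvalue_nonneg[OF H] by (intro mult_left_mono) (simp_all add: p1)
    finally have "(norm ?K)\<^sup>2 \<le> b\<^sup>2 * (norm ?P)\<^sup>2" using n by (simp add: mult.left_commute)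
    then show ?thesis by (simp add: b_def p1 power_mult_distrib mult_ac)
  next
    case MInf
    then show ?thesis using q by simp
  qed
  then show ?thesis by (rule power2_le_imp_le) (simp add: power_sum_norm_nonneg)
qed

lemma ttranspose_cross:
  "ttranspose (ttranspose C \<star> A + ttranspose D \<star> B) = ttranspose A \<star> C + ttranspose B \<star> D"
  (is "ttranspose ?K = ?K'")
proof -
  have "bcirc (ttranspose ?K) = bcirc ?K'"
    by (simp add: bcirc_ttranspose bcirc_cross matrix_transpose_mul transpose_add)
  then show ?thesis by (simp add: bcirc_inject)
qed

lemma spectral_norm_ttranspose:
  fixes A :: "('n::finite, 'n, 'k::{finite,linorder}) tensor"
  shows "spectral_norm (ttranspose A) = spectral_norm A"
proof -
  have le: "onorm ((*v) (transpose M)) \<le> onorm ((*v) M)" for M :: "real^'m::finite^'m"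
  proof (rule onorm_le)
    fix x
    let ?y = "transpose M *v x"
    have "?y \<bullet> ?y = (M *v ?y) \<bullet> x" by (rule inner_transpose_matrix)
    also have "\<dots> \<le> norm (M *v ?y) * norm x" by (rule norm_cauchy_schwarz)
    also have "\<dots> \<le> (onorm ((*v) M) * norm ?y) * norm x"
      by (intro mult_right_mono onorm matrix_vector_mul_bounded_linear) simp
    finally have "norm ?y * norm ?y \<le> norm ?y * (onorm ((*v) M) * norm x)"
      by (simp only: power2_norm_eq_inner[symmetric]) (simp only: power2_eq_square mult_ac)
    then show "norm ?y \<le> onorm ((*v) M) * norm x"
      using onorm_pos_le[OF matrix_vector_mul_bounded_linear[of M]]
      by (cases "?y = 0") auto
  qed
  show ?thesis
    using le[of "bcirc A"] le[of "transpose (bcirc A)"]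
    by (simp add: spectral_norm_def bcirc_ttranspose)
qed

lemma norm_ttranspose:
  fixes A :: "('n::finite, 'n, 'k::{finite,linorder}) tensor"
  shows "norm (ttranspose A) = norm A"
proof -
  have "(norm (transpose M))\<^sup>2 = (norm M)\<^sup>2" for M :: "real^'m::finite^'m"
    unfolding power2_norm_eq_inner
    by (simp add: inner_vec_def transpose_def) (rule sum.swap)
  then have "real CARD('k) * (norm (ttranspose A))\<^sup>2 = real CARD('k) * (norm A)\<^sup>2"
    by (simp only: norm_bcirc[symmetric] bcirc_ttranspose)
  then show ?thesis by simp
qed

text \<open>The second equation shows that the exponent of the number of slices in the
theorem is 0, and the third statement makes \<open>p \<le> 2 \<le> q\<close> hold up to an exchange of \<open>p\<close>
and \<open>q\<close>.\<close>

lemma ereal_conjugate_exponents: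
  fixes p q :: ereal
  assumes "1 \<le> p" "1 \<le> q" "1 / p + 1 / q = 1"
  shows "real_of_ereal (1 / p) + real_of_ereal (1 / q) = 1"
    and "real_of_ereal (1 / (2 * p)) + real_of_ereal (1 / (2 * q)) = 1 / 2"
    and "p \<le> 2 \<and> 2 \<le> q \<or> q \<le> 2 \<and> 2 \<le> p"
proof -
  consider (finite) r s where "p = ereal r" "q = ereal s" "1 \<le> r" "1 \<le> s" "1 / r + 1 / s = 1"
    | (left) "p = \<infinity>" "q = 1" | (right) "p = 1" "q = \<infinity>"
    using assms by (cases p; cases q) (auto simp: one_ereal_def)
  then have "real_of_ereal (1 / p) + real_of_ereal (1 / q) = 1
    \<and> real_of_ereal (1 / (2 * p)) + real_of_ereal (1 / (2 * q)) = 1 / 2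
    \<and> (p \<le> 2 \<and> 2 \<le> q \<or> q \<le> 2 \<and> 2 \<le> p)"
  proof cases
    case finite
    have "r \<le> 2 \<longleftrightarrow> 1 / 2 \<le> 1 / r" "2 \<le> r \<longleftrightarrow> 1 / r \<le> 1 / 2"
      "s \<le> 2 \<longleftrightarrow> 1 / 2 \<le> 1 / s" "2 \<le> s \<longleftrightarrow> 1 / s \<le> 1 / 2"
      using finite by (auto simp: field_simps)
    then have "r \<le> 2 \<and> 2 \<le> s \<or> s \<le> 2 \<and> 2 \<le> r" using finite(5) by linarith
    moreover have "2 * p = ereal (2 * r)" "2 * q = ereal (2 * s)" using finite by simp_all
    moreover have "1 / (2 * r) + 1 / (2 * s) = (1 / r + 1 / s) / 2" by (simp add: add_divide_distrib)
    ultimately show ?thesis using finite by (simp add: one_ereal_def)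
  qed (auto simp: one_ereal_def)
  then show "real_of_ereal (1 / p) + real_of_ereal (1 / q) = 1"
    "real_of_ereal (1 / (2 * p)) + real_of_ereal (1 / (2 * q)) = 1 / 2"
    "p \<le> 2 \<and> 2 \<le> q \<or> q \<le> 2 \<and> 2 \<le> p" by blast+
qed

theorem theorem4p5:
  fixes A B C D :: "('n::finite, 'n, 'k::{finite,linorder}) tensor"
    and p q :: ereal
  assumes "1 \<le> p" and "1 \<le> q" and "1 / p + 1 / q = 1"
  shows "(2 powr (- \<bar>real_of_ereal (1 / p) - 1 / 2\<bar>)
           * norm (ttranspose C \<star> A + ttranspose D \<star> B)
         \<le> real CARD('k) powr (real_of_ereal (1 / (2 * p)) + real_of_ereal (1 / (2 * q)) - 1 / 2)
             * (power_sum_norm norm p A B * power_sum_norm norm q C D))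
     \<and> (2 powr (- \<bar>real_of_ereal (1 / p) - 1 / 2\<bar>)
           * spectral_norm (ttranspose C \<star> A + ttranspose D \<star> B)
         \<le> power_sum_norm spectral_norm p A B * power_sum_norm spectral_norm q C D)"
proof -
  have half: "2 powr (- \<bar>real_of_ereal (1 / p) - 1 / 2\<bar>) * norm (ttranspose C \<star> A + ttranspose D \<star> B)
        \<le> power_sum_norm norm p A B * power_sum_norm norm q C D
      \<and> 2 powr (- \<bar>real_of_ereal (1 / p) - 1 / 2\<bar>) * spectral_norm (ttranspose C \<star> A + ttranspose D \<star> B)
        \<le> power_sum_norm spectral_norm p A B * power_sum_norm spectral_norm q C D"
    if p: "1 \<le> p" "p \<le> 2" and q: "2 \<le> q" and pq: "real_of_ereal (1 / p) + real_of_ereal (1 / q) = 1"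
    for p q :: ereal and A B C D :: "('n, 'n, 'k) tensor"
  proof -
    obtain r where r: "p = ereal r" "1 \<le> r" "r \<le> 2" using p by (cases p) auto
    then have p': "real_of_ereal (1 / p) = 1 / r" by (simp add: one_ereal_def)
    have "1 / 2 \<le> 1 / r" using r by (simp add: field_simps)
    then have exponent: "\<bar>real_of_ereal (1 / p) - 1 / 2\<bar> = 1 / r - 1 / 2"
      "1 / 2 - real_of_ereal (1 / q) = 1 / r - 1 / 2"
      using pq unfolding p' by linarith+
    have cancel: "2 powr (- a) * x \<le> y" if "x \<le> 2 powr a * y" for a x y :: real
      using that by (simp add: powr_minus field_simps)
    have "1 / r + real_of_ereal (1 / q) = 1" using pq p' by simp
    then show ?thesis
      using cancel[OF frobenius_norm_cross_le[OF r(2,3) q]]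
        cancel[OF spectral_norm_cross_le[OF r(2,3) q, unfolded exponent(2)]]
      unfolding exponent(1) unfolding r(1) by blast
  qed
  note conj = ereal_conjugate_exponents[OF assms]
  have factor: "real CARD('k) powr (real_of_ereal (1 / (2 * p)) + real_of_ereal (1 / (2 * q)) - 1 / 2) = 1"
    unfolding conj(2) by simp
  have "2 powr (- \<bar>real_of_ereal (1 / p) - 1 / 2\<bar>) * norm (ttranspose C \<star> A + ttranspose D \<star> B)
        \<le> power_sum_norm norm p A B * power_sum_norm norm q C D
      \<and> 2 powr (- \<bar>real_of_ereal (1 / p) - 1 / 2\<bar>) * spectral_norm (ttranspose C \<star> A + ttranspose D \<star> B)
        \<le> power_sum_norm spectral_norm p A B * power_sum_norm spectral_norm q C D"
    using conj(3)
  proof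
    assume "p \<le> 2 \<and> 2 \<le> q"
    then show ?thesis using half assms(1) conj(1) by blast
  next
    assume "q \<le> 2 \<and> 2 \<le> p"
    moreover have "\<bar>real_of_ereal (1 / p) - 1 / 2\<bar> = \<bar>real_of_ereal (1 / q) - 1 / 2\<bar>"
      using conj(1) by linarith
    moreover have "norm (ttranspose C \<star> A + ttranspose D \<star> B) = norm (ttranspose A \<star> C + ttranspose B \<star> D)"
      "spectral_norm (ttranspose C \<star> A + ttranspose D \<star> B) = spectral_norm (ttranspose A \<star> C + ttranspose B \<star> D)"
      by (metis norm_ttranspose ttranspose_cross, metis spectral_norm_ttranspose ttranspose_cross)
    ultimately show ?thesis using half[of q p A C B D] assms(2) conj(1) by (simp add: add.commute mult.commute)
  qed
  then show ?thesis by (simp only: factor mult_1)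
qed

end
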